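(* Let $M\ge1$ be an integer. If $f:\mathbb R^2\to\mathbb R$ is a $C^1$ function such that its partial derivatives do not vanish in $(M+1-\delta,M+1]^2$ for some $\delta>0$, then for any $x\in(0,1]$ the set $$\mathcal U_f(x):=\{f(p,q): p,q\in\mathcal U(x)\}$$ contains an interval.
   Context: Fix an integer $M\ge1$. For $q\in(1,M+1]$, an expansion of $x\ge0$ in base $q$ is a sequence $(d_i)\in\{0,1,\ldots,M\}^{\mathbb N}$ with $x=\sum_{i=1}^\infty d_iq^{-i}$. $\mathcal U(x)$ is the set of all $q\in(1,M+1]$ for which $x$ has exactly one expansion in base $q$. "Interval" means an interval of positive length. *)

theory Defs
  imports "HOL-Analysis.Analysis"
begin

text \<open>Digit sequences are indexed from 0, so \<open>d i\<close> is the digit \<open>d_(i+1)\<close> of the usual notation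
  \<open>x = \<Sum>i\<ge>1. d_i / q^i\<close>.\<close>

definition is_expansion :: "nat \<Rightarrow> real \<Rightarrow> real \<Rightarrow> (nat \<Rightarrow> nat) \<Rightarrow> bool" where
  "is_expansion M q x d \<longleftrightarrow>
     (\<forall>i. d i \<in> {0..M}) \<and> (\<lambda>i. real (d i) / q ^ Suc i) sums x"

definition univoque_bases :: "nat \<Rightarrow> real \<Rightarrow> real set" where
  "univoque_bases M x = {q \<in> {1<..real M + 1}. \<exists>!d. is_expansion M q x d}"

definition C1 :: "('a::real_normed_vector \<Rightarrow> 'b::real_normed_vector) \<Rightarrow> bool" where
  "C1 f \<longleftrightarrow> (\<exists>f' :: 'a \<Rightarrow> ('a \<Rightarrow>\<^sub>L 'b).
     (\<forall>z. (f has_derivative blinfun_apply (f' z)) (at z)) \<and> continuous_on UNIV f')"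

text \<open>\<open>deriv\<close> is only meaningful where the partial derivative exists, as it does for \<open>C1\<close> functions.\<close>

definition partial_fst :: "(real \<times> real \<Rightarrow> real) \<Rightarrow> real \<times> real \<Rightarrow> real" where
  "partial_fst f = (\<lambda>(p, q). deriv (\<lambda>s. f (s, q)) p)"

definition partial_snd :: "(real \<times> real \<Rightarrow> real) \<Rightarrow> real \<times> real \<Rightarrow> real" where
  "partial_snd f = (\<lambda>(p, q). deriv (\<lambda>t. f (p, t)) q)"

definition univoque_image :: "nat \<Rightarrow> (real \<times> real \<Rightarrow> real) \<Rightarrow> real \<Rightarrow> real set" where
  "univoque_image M f x = {f (p, q) | p q. p \<in> univoque_bases M x \<and> q \<in> univoque_bases M x}"

end

theory Submission
  imports Defs
begin

text \<open>Write \<open>Q = M + 1\<close>. Just below \<open>Q\<close> the univoque bases of \<open>x\<close> contain Cantor sets whose gaps are as short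
  as desired in comparison with the neighbouring pieces, and a level curve of a function that is
  bi-Lipschitz in each variable cannot slip through the gaps of the product of two such sets.

  \<^emph>\<open>The Cantor set.\<close> After the digits of a word \<open>u\<close>, the remainder \<open>t\<close> (the number that the
  remaining digits must represent) is a polynomial in the base \<open>q\<close>. A digit is the only possible one
  if the remainder behind it lies strictly between \<open>M / (q - 1) - 1\<close> and \<open>1\<close>, and the lower bound
  tends to \<open>0\<close> as \<open>q\<close> tends to \<open>Q\<close>. Fix a block length \<open>K\<close> and let \<open>\<rho> = 1 / Q ^ K\<close>. If the
  remainder lies in \<open>[\<rho>, 1 - \<rho>]\<close> at the end of every block of \<open>K\<close> digits, then all these digits are
  forced as soon as \<open>M / (q - 1) - 1 < \<rho>\<^sup>2\<close>. The bases for which the remainder behind \<open>u\<close> lies in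
  \<open>[\<rho>, 1 - \<rho>]\<close> form an interval, and since the remainder grows in \<open>q\<close> with a slope comparable to
  \<open>q ^ length u\<close>, the intervals of the words that extend \<open>u\<close> by one block have relative length about
  \<open>\<rho>\<close>, while the gaps between them have relative length about \<open>\<rho>\<^sup>2\<close>; the constants depend on \<open>x\<close>
  only (\<open>node_refine\<close>). Hence the ratio of gaps to pieces is arbitrarily small for large \<open>K\<close>.

  \<^emph>\<open>The level curve.\<close> Let \<open>f (p, q) = t\<close> with \<open>p\<close> in such an interval \<open>I\<close> and \<open>q\<close> in the middle
  half of another one, \<open>J\<close>, of comparable length. Slide along the level curve until \<open>q\<close> is the
  centre of a subinterval \<open>J'\<close> of \<open>J\<close>; this costs \<open>p\<close> about \<open>\<rho> |J|\<close>, which keeps it in \<open>I\<close>. Then move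
  \<open>p\<close> out of the gap in which it may have landed; this costs \<open>q\<close> about \<open>\<rho>\<^sup>2 |I|\<close>, which keeps it in
  the middle half of \<open>J'\<close>. Iterating gives nested intervals, whose limit is a pair of points of the
  Cantor set with the value \<open>t\<close>. The intervals around \<open>p\<close> and \<open>q\<close> shrink at different rates, because
  the rate is the base itself, so \<open>I\<close> is refined as often as is needed to keep the two lengths
  comparable (\<open>balanced_step\<close>, \<open>image_contains_interval\<close>).

  \<^emph>\<open>The start.\<close> A first interval is needed on which the digits before the blocks are forced too.
  They are taken from the quasi-greedy expansion of \<open>x\<close> in base \<open>Q\<close>, all remainders of which lie in
  \<open>(0, 1]\<close>, up to a place at which the remainder is at least \<open>1 / Q\<close>; the bases considered are so close
  to \<open>Q\<close> that this last remainder drops by a small fixed amount only (\<open>node_exists\<close>).\<close>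


section \<open>Families of intervals with relatively small gaps\<close>

text \<open>The Cantor set that is carved out by the family. In the application short intervals of bases belong
  to long forced words, so these points are bases in which every digit is forced.\<close>

definition fine_points :: "(real \<times> real) set \<Rightarrow> real set" where
  "fine_points \<N> = {p. \<forall>e>0. \<exists>a b. (a, b) \<in> \<N> \<and> p \<in> {a..b} \<and> b - a < e}"

text \<open>The parameters \<open>\<alpha>\<close> and \<open>\<beta>\<close> bound the relative lengths of the subintervals, and \<open>h\<close> the relative
  length of the gaps between them. The theory is of interest when \<open>h\<close> is much smaller than \<open>\<alpha>\<close>, so that
  gaps are negligible against pieces.\<close>

locale interval_family =
  fixes \<N> :: "(real \<times> real) set" and \<alpha> \<beta> h :: real
  assumes nondegenerate: "(a, b) \<in> \<N> \<Longrightarrow> a < b"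
    and refine: "(a, b) \<in> \<N> \<Longrightarrow> p \<in> {a..b} \<Longrightarrow>
      \<exists>a' b' p'. (a', b') \<in> \<N> \<and> a \<le> a' \<and> b' \<le> b \<and> \<alpha> * (b - a) \<le> b' - a' \<and> b' - a' \<le> \<beta> * (b - a)
        \<and> p' \<in> {a'..b'} \<and> \<bar>p' - p\<bar> \<le> h * (b - a)"
    and \<alpha>_pos: "0 < \<alpha>" and \<beta>_le: "\<beta> \<le> 1/2" and h_nonneg: "0 \<le> h"
begin

text \<open>Repeated refinement reaches a prescribed length up to the factor \<open>\<alpha>\<close>. Lengths are at least halved in
  every step, so the displacements of the point form a series dominated by a geometric one, and the
  total is at most twice the first bound.\<close>

lemma refine_to_size:
  assumes "(a, b) \<in> \<N>" "p \<in> {a..b}" "0 < s" "\<alpha> * s \<le> b - a"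
  shows "\<exists>a' b' p'. (a', b') \<in> \<N> \<and> a \<le> a' \<and> b' \<le> b \<and> \<alpha> * s \<le> b' - a' \<and> b' - a' \<le> s
           \<and> p' \<in> {a'..b'} \<and> \<bar>p' - p\<bar> \<le> 2 * h * (b - a)"
proof -
  obtain n where "(b - a) / s < 2 ^ n"
    using real_arch_pow[of 2 "(b - a) / s"] by auto
  then have "b - a \<le> 2 ^ n * s"
    using assms(3) by (simp add: field_simps)
  then show ?thesis
    using assms
  proof (induction n arbitrary: a b p)
    case 0
    then have "\<bar>p - p\<bar> \<le> 2 * h * (b - a)"
      using nondegenerate[of a b] h_nonneg by simp
    then show ?case
      using 0 by (intro exI[of _ a] exI[of _ b] exI[of _ p]) auto
  next
    case (Suc n)
    show ?case
    proof (cases "b - a \<le> s")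
      case True
      have "\<bar>p - p\<bar> \<le> 2 * h * (b - a)"
        using nondegenerate[of a b] h_nonneg Suc.prems by simp
      then show ?thesis
        using Suc.prems True by (intro exI[of _ a] exI[of _ b] exI[of _ p]) auto
    next
      case False
      obtain a1 b1 p1 where 1: "(a1, b1) \<in> \<N>" "a \<le> a1" "b1 \<le> b" "\<alpha> * (b - a) \<le> b1 - a1"
        "b1 - a1 \<le> \<beta> * (b - a)" "p1 \<in> {a1..b1}" "\<bar>p1 - p\<bar> \<le> h * (b - a)"
        using refine[OF Suc.prems(2,3)] by blast
      have "\<beta> * (b - a) \<le> 1 / 2 * (b - a)"
        using \<beta>_le nondegenerate[OF Suc.prems(2)] by (intro mult_right_mono) auto
      then have half: "b1 - a1 \<le> (b - a) / 2"
        using 1(5) by linarith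
      have "\<alpha> * s \<le> b1 - a1"
        using 1(4) mult_left_mono[of s "b - a" \<alpha>] False \<alpha>_pos by linarith
      moreover have "b1 - a1 \<le> 2 ^ n * s"
        using half Suc.prems(1) by simp
      ultimately obtain a2 b2 p2 where 2: "(a2, b2) \<in> \<N>" "a1 \<le> a2" "b2 \<le> b1" "\<alpha> * s \<le> b2 - a2"
        "b2 - a2 \<le> s" "p2 \<in> {a2..b2}" "\<bar>p2 - p1\<bar> \<le> 2 * h * (b1 - a1)"
        using Suc.IH[OF _ 1(1) 1(6) assms(3)] by blast
      have "2 * h * (b1 - a1) \<le> h * (b - a)"
        using mult_left_mono[OF half, of "2 * h"] h_nonneg by simp
      then have "\<bar>p2 - p\<bar> \<le> 2 * h * (b - a)"
        using 2(7) 1(7) by linarith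
      then show ?thesis
        using 1 2 by (intro exI[of _ a2] exI[of _ b2] exI[of _ p2]) auto
    qed
  qed
qed

end

section \<open>Level curves through products of such families\<close>

text \<open>An expanding continuous function is injective, hence strictly monotone, so on an interval of
  radius \<open>e\<close> it attains all values within \<open>m * e\<close> of the central one.\<close>

lemma solve_near:
  fixes g :: "real \<Rightarrow> real"
  assumes cont: "continuous_on {q - e..q + e} g" and "0 \<le> e" "0 < m"
    and expand: "\<And>s s'. s \<in> {q - e..q + e} \<Longrightarrow> s' \<in> {q - e..q + e} \<Longrightarrow> m * \<bar>s - s'\<bar> \<le> \<bar>g s - g s'\<bar>"
    and close: "\<bar>g q - t\<bar> \<le> m * e"
  shows "\<exists>q'. \<bar>q' - q\<bar> \<le> e \<and> g q' = t"
proof (cases "e = 0")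
  case True
  then show ?thesis
    using close by (intro exI[of _ q]) auto
next
  case False
  then have "0 < e"
    using assms(2) by simp
  have "inj_on g {q - e..q + e}"
  proof (rule inj_onI)
    fix s s' assume "s \<in> {q - e..q + e}" "s' \<in> {q - e..q + e}" "g s = g s'"
    then have "m * \<bar>s - s'\<bar> \<le> 0"
      using expand[of s s'] by simp
    then show "s = s'"
      using \<open>0 < m\<close> by (simp add: mult_le_0_iff)
  qed
  then have mono: "g (q - e) < g q \<and> g q < g (q + e) \<or> g (q + e) < g q \<and> g q < g (q - e)"
    using continuous_inj_imp_mono[of "q - e" q "q + e" g] cont \<open>0 < e\<close> by auto
  have *: "m * e \<le> \<bar>g (q - e) - g q\<bar>" "m * e \<le> \<bar>g (q + e) - g q\<bar>"
    using expand[of "q - e" q] expand[of "q + e" q] \<open>0 < e\<close> by auto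
  have "\<exists>q'. q - e \<le> q' \<and> q' \<le> q + e \<and> g q' = t"
    using mono
  proof
    assume "g (q - e) < g q \<and> g q < g (q + e)"
    then show ?thesis
      using IVT'[of g "q - e" t "q + e"] * close cont \<open>0 < e\<close> by auto
  next
    assume "g (q + e) < g q \<and> g q < g (q - e)"
    then show ?thesis
      using IVT2'[of g "q + e" t "q - e"] * close cont \<open>0 < e\<close> by auto
  qed
  then obtain q' where "q - e \<le> q'" "q' \<le> q + e" "g q' = t"
    by blast
  then show ?thesis
    by (intro exI[of _ q']) auto
qed

text \<open>The constant \<open>L\<close> bounds the slopes of the level curves of \<open>f\<close> in both directions. The number \<open>r\<close>
  describes the admissible ratio of the lengths of the two intervals around a point of a level curve:
  the first one divided by the second one has to lie between \<open>r\<close> and \<open>r / \<alpha>\<close>. The three smallness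
  conditions are what one step of the construction consumes: \<open>small1\<close> and \<open>small2\<close> leave room for
  moving the second coordinate to the centre of a subinterval, \<open>small3\<close> for moving the first
  coordinate out of a gap.\<close>

locale level_sets = interval_family +
  fixes f :: "real \<times> real \<Rightarrow> real" and S :: "real set" and m L r :: real
  assumes inside: "(a, b) \<in> \<N> \<Longrightarrow> {a..b} \<subseteq> S"
    and cont: "continuous_on UNIV f"
    and m_pos: "0 < m"
    and fst_expand: "p \<in> S \<Longrightarrow> p' \<in> S \<Longrightarrow> q \<in> S \<Longrightarrow> m * \<bar>p - p'\<bar> \<le> \<bar>f (p, q) - f (p', q)\<bar>"
    and fst_lip: "p \<in> S \<Longrightarrow> p' \<in> S \<Longrightarrow> q \<in> S \<Longrightarrow> \<bar>f (p, q) - f (p', q)\<bar> \<le> m * L * \<bar>p - p'\<bar>"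
    and snd_expand: "p \<in> S \<Longrightarrow> q \<in> S \<Longrightarrow> q' \<in> S \<Longrightarrow> m * \<bar>q - q'\<bar> \<le> \<bar>f (p, q) - f (p, q')\<bar>"
    and snd_lip: "p \<in> S \<Longrightarrow> q \<in> S \<Longrightarrow> q' \<in> S \<Longrightarrow> \<bar>f (p, q) - f (p, q')\<bar> \<le> m * L * \<bar>q - q'\<bar>"
    and L_ge: "1 \<le> L" and r_pos: "0 < r"
    and small1: "4 * L * (\<beta> + h) \<le> r"
    and small2: "4 * L^2 * (\<beta> + h) \<le> 1"
    and small3: "8 * L * h * r \<le> \<alpha>^2"
begin

text \<open>Following a level curve: the Lipschitz bound limits the change of value that a displacement of the
  first coordinate causes, and the expansion bound allows the second coordinate to undo it nearby.\<close>

lemma move_snd: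
  assumes "p \<in> S" "p' \<in> S" "\<bar>p' - p\<bar> \<le> e" "{q - L * e..q + L * e} \<subseteq> S"
  shows "\<exists>q'. \<bar>q' - q\<bar> \<le> L * e \<and> f (p', q') = f (p, q)"
proof (rule solve_near[where m = m])
  show "0 \<le> L * e"
    using assms(3) L_ge by simp
  then have "q \<in> S"
    using assms(4) by auto
  have "m * L * \<bar>p' - p\<bar> \<le> m * L * e"
    using assms(3) m_pos L_ge by (intro mult_left_mono) auto
  then show "\<bar>f (p', q) - f (p, q)\<bar> \<le> m * (L * e)"
    using fst_lip[OF assms(2,1) \<open>q \<in> S\<close>] by (simp add: mult.assoc)
  show "continuous_on {q - L * e..q + L * e} (\<lambda>q'. f (p', q'))"
    by (intro continuous_on_compose2[OF cont] continuous_intros) auto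
  show "m * \<bar>s - s'\<bar> \<le> \<bar>f (p', s) - f (p', s')\<bar>"
    if "s \<in> {q - L * e..q + L * e}" "s' \<in> {q - L * e..q + L * e}" for s s'
    using that assms(2,4) by (intro snd_expand) auto
qed (rule m_pos)

lemma move_fst:
  assumes "q \<in> S" "q' \<in> S" "\<bar>q' - q\<bar> \<le> e" "{p - L * e..p + L * e} \<subseteq> S"
  shows "\<exists>p'. \<bar>p' - p\<bar> \<le> L * e \<and> f (p', q') = f (p, q)"
proof (rule solve_near[where m = m])
  show "0 \<le> L * e"
    using assms(3) L_ge by simp
  then have "p \<in> S"
    using assms(4) by auto
  have "m * L * \<bar>q' - q\<bar> \<le> m * L * e"
    using assms(3) m_pos L_ge by (intro mult_left_mono) auto
  then show "\<bar>f (p, q') - f (p, q)\<bar> \<le> m * (L * e)"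
    using snd_lip[OF \<open>p \<in> S\<close> assms(2,1)] by (simp add: mult.assoc)
  show "continuous_on {p - L * e..p + L * e} (\<lambda>p'. f (p', q'))"
    by (intro continuous_on_compose2[OF cont] continuous_intros) auto
  show "m * \<bar>s - s'\<bar> \<le> \<bar>f (s, q') - f (s', q')\<bar>"
    if "s \<in> {p - L * e..p + L * e}" "s' \<in> {p - L * e..p + L * e}" for s s'
    using that assms(2,4) by (intro fst_expand) auto
qed (rule m_pos)

text \<open>The state of the construction. Only the second point is kept away from the ends of its interval;
  the first one may be an endpoint.\<close>

definition balanced :: "real \<Rightarrow> real \<times> real \<times> real \<times> real \<times> real \<times> real \<Rightarrow> bool" where
  "balanced t = (\<lambda>(a, b, c, d, p, q). (a, b) \<in> \<N> \<and> (c, d) \<in> \<N> \<and> p \<in> {a..b}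
     \<and> q \<in> {c + (d - c) / 4..d - (d - c) / 4} \<and> f (p, q) = t
     \<and> r * (d - c) \<le> b - a \<and> \<alpha> * (b - a) \<le> r * (d - c))"

lemma balanced_step:
  assumes "balanced t (a, b, c, d, p, q)"
  shows "\<exists>a' b' c' d' p' q'. balanced t (a', b', c', d', p', q')
    \<and> a \<le> a' \<and> b' \<le> b \<and> c \<le> c' \<and> d' \<le> d \<and> d' - c' \<le> (d - c) / 2"
proof -
  define l where "l = d - c"
  define e where "e = (\<beta> + h) * l"
  have I: "(a, b) \<in> \<N>" and J: "(c, d) \<in> \<N>" and p: "p \<in> {a..b}" and q: "q \<in> {c + l / 4..d - l / 4}"
    and f: "f (p, q) = t" and ratio: "r * l \<le> b - a" "\<alpha> * (b - a) \<le> r * l"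
    using assms by (auto simp: balanced_def l_def)
  have l: "0 < l" "l = d - c"
    using nondegenerate[OF J] by (auto simp: l_def)
  have ab: "a < b"
    using nondegenerate[OF I] .
  have inS: "{a..b} \<subseteq> S" "{c..d} \<subseteq> S"
    using inside I J by auto
  \<comment> \<open>\<open>\<beta>\<close> bounds the length of some actual subinterval and therefore cannot be negative.\<close>
  have "0 \<le> \<beta> + h"
  proof -
    obtain a' b' where "(a', b') \<in> \<N>" "b' - a' \<le> \<beta> * (b - a)"
      using refine[OF I p] by blast
    with nondegenerate have "0 < \<beta> * (b - a)"
      by (smt (verit))
    then have "0 < \<beta>"
      using ab by (simp add: zero_less_mult_iff)
    with h_nonneg show ?thesis by simp
  qed
  then have e0: "0 \<le> e"
    using l by (simp add: e_def)
  have Le: "4 * (L * e) \<le> b - a"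
  proof -
    have "4 * (L * e) = 4 * L * (\<beta> + h) * l"
      by (simp add: e_def)
    also have "\<dots> \<le> r * l"
      using small1 l by (intro mult_right_mono) auto
    finally show ?thesis
      using ratio by simp
  qed
  have LLe: "4 * (L * (L * e)) \<le> l"
  proof -
    have "4 * (L * (L * e)) = 4 * L^2 * (\<beta> + h) * l"
      by (simp add: e_def power2_eq_square)
    also have "\<dots> \<le> 1 * l"
      using small2 l by (intro mult_right_mono) auto
    finally show ?thesis by simp
  qed
  have Le0: "0 \<le> L * e"
    using e0 L_ge by simp
  \<comment> \<open>Move \<open>p\<close> by \<open>L * e\<close> towards the centre of its interval, so that it can afterwards absorb another displacement of up to \<open>L * e\<close> in either direction.\<close>
  define p1 where "p1 = (if p \<le> (a + b) / 2 then p + L * e else p - L * e)"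
  have p1: "\<bar>p1 - p\<bar> \<le> L * e" "{p1 - L * e..p1 + L * e} \<subseteq> {a..b}"
    using p Le Le0 by (auto simp: p1_def field_simps)
  then have "p1 \<in> {a..b}"
    using Le0 by auto
  have "{q - L * (L * e)..q + L * (L * e)} \<subseteq> {c..d}"
    using q LLe by auto
  then obtain q1 where q1: "\<bar>q1 - q\<bar> \<le> L * (L * e)" "f (p1, q1) = t"
    using move_snd[of p p1 "L * e" q] p1 p \<open>p1 \<in> {a..b}\<close> inS f by blast
  have "q1 \<in> {c..d}"
    using q1 q LLe by auto
  obtain c' d' q2' where J': "(c', d') \<in> \<N>" "c \<le> c'" "d' \<le> d" "\<alpha> * l \<le> d' - c'"
    "d' - c' \<le> \<beta> * l" "q2' \<in> {c'..d'}" "\<bar>q2' - q1\<bar> \<le> h * l"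
    using refine[OF J \<open>q1 \<in> {c..d}\<close>] l by blast
  have cd': "c' < d'"
    using nondegenerate[OF J'(1)] .
  \<comment> \<open>The second point is brought to the centre of a subinterval near its present position; the first point absorbs this.\<close>
  define q2 where "q2 = (c' + d') / 2"
  have q2: "q2 \<in> {c'..d'}"
    using cd' by (auto simp: q2_def)
  have "\<bar>q2 - q2'\<bar> \<le> \<beta> * l"
    using q2 J' by auto
  then have "\<bar>q2 - q1\<bar> \<le> e"
    using J'(7) by (simp add: e_def distrib_right)
  moreover have "q1 \<in> S" "q2 \<in> S" "{p1 - L * e..p1 + L * e} \<subseteq> S"
    using p1(2) inS q2 J'(2,3) \<open>q1 \<in> {c..d}\<close> by auto
  ultimately obtain p2 where p2: "\<bar>p2 - p1\<bar> \<le> L * e" "f (p2, q2) = t"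
    using move_fst[of q1 q2 e p1] q1(2) by auto
  have "p2 \<in> {p1 - L * e..p1 + L * e}"
    using p2(1) by auto
  then have p2I: "p2 \<in> {a..b}"
    using p1(2) by blast
  \<comment> \<open>The length at which the upper bound for the ratio is attained; refining down to it restores both bounds.\<close>
  define s where "s = r * (d' - c') / \<alpha>"
  have s: "0 < s" "\<alpha> * s = r * (d' - c')"
    using r_pos \<alpha>_pos cd' by (auto simp: s_def)
  have "r * (d' - c') \<le> r * l"
    using r_pos J' l by (intro mult_left_mono) auto
  then have "\<alpha> * s \<le> b - a"
    using s ratio by simp
  then obtain a' b' p3 where I': "(a', b') \<in> \<N>" "a \<le> a'" "b' \<le> b" "\<alpha> * s \<le> b' - a'"
    "b' - a' \<le> s" "p3 \<in> {a'..b'}" "\<bar>p3 - p2\<bar> \<le> 2 * h * (b - a)"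
    using refine_to_size[OF I p2I s(1)] by blast
  have shift: "L * (2 * h * (b - a)) \<le> (d' - c') / 4"
  proof -
    have "\<alpha> * (L * (2 * h * (b - a))) = 2 * L * h * (\<alpha> * (b - a))"
      by simp
    also have "\<dots> \<le> 2 * L * h * (r * l)"
      using ratio L_ge h_nonneg by (intro mult_left_mono) auto
    also have "\<dots> = (8 * L * h * r) * l / 4"
      by simp
    also have "\<dots> \<le> \<alpha>^2 * l / 4"
      using small3 l by (intro divide_right_mono mult_right_mono) auto
    also have "\<dots> = \<alpha> * (\<alpha> * l / 4)"
      by (simp add: power2_eq_square)
    finally have "L * (2 * h * (b - a)) \<le> \<alpha> * l / 4"
      using \<alpha>_pos by simp
    then show ?thesis
      using J'(4) by simp
  qed
  then have "{q2 - L * (2 * h * (b - a))..q2 + L * (2 * h * (b - a))} \<subseteq> {c'..d'}"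
    using cd' by (auto simp: q2_def field_simps)
  then have "{q2 - L * (2 * h * (b - a))..q2 + L * (2 * h * (b - a))} \<subseteq> S"
    using inside[OF J'(1)] by blast
  moreover have "p2 \<in> S" "p3 \<in> S"
    using p2I I' inS by auto
  ultimately obtain q3 where q3: "\<bar>q3 - q2\<bar> \<le> L * (2 * h * (b - a))" "f (p3, q3) = t"
    using move_snd[of p2 p3 "2 * h * (b - a)" q2] I'(7) p2(2) by auto
  have "q3 \<in> {c' + (d' - c') / 4..d' - (d' - c') / 4}"
    using q3(1) shift by (auto simp: q2_def abs_le_iff field_simps)
  moreover have "\<alpha> * (b' - a') \<le> r * (d' - c')"
    using mult_left_mono[OF I'(5), of \<alpha>] \<alpha>_pos s by simp
  moreover have "d' - c' \<le> (d - c) / 2"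
  proof -
    have "\<beta> * l \<le> 1 / 2 * l"
      using \<beta>_le l by (intro mult_right_mono) auto
    then have "d' - c' \<le> l / 2"
      using J'(5) by simp
    then show ?thesis
      using l(2) by simp
  qed
  ultimately have "balanced t (a', b', c', d', p3, q3)" "d' - c' \<le> (d - c) / 2"
    using I' J' q3 s by (auto simp: balanced_def)
  then show ?thesis
    using I'(2,3) J'(2,3) by blast
qed

text \<open>The step can be iterated, and both sequences of intervals shrink to points because the second
  lengths are halved and the first ones stay proportional to them.\<close>

lemma balanced_value:
  assumes "balanced t s0"
  shows "\<exists>p\<in>fine_points \<N>. \<exists>q\<in>fine_points \<N>. f (p, q) = t"
proof -
  define nested where "nested = (\<lambda>(a :: real, b :: real, c :: real, d :: real, p :: real, q :: real) (a', b', c', d', p' :: real, q' :: real).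
     a \<le> a' \<and> b' \<le> b \<and> c \<le> c' \<and> d' \<le> d \<and> d' - c' \<le> (d - c) / 2)"
  have "\<exists>\<sigma>. \<forall>n. balanced t (\<sigma> n) \<and> nested (\<sigma> n) (\<sigma> (Suc n))"
  proof (rule dependent_nat_choice)
    show "\<exists>s. balanced t s"
      using assms by blast
    show "\<exists>s'. balanced t s' \<and> nested s s'" if "balanced t s" for s and n :: nat
      using balanced_step[of t] that by (cases s) (fastforce simp: nested_def)
  qed
  then obtain \<sigma> where \<sigma>: "\<And>n. balanced t (\<sigma> n)" "\<And>n. nested (\<sigma> n) (\<sigma> (Suc n))"
    by blast
  define a b c d p q where "a n = fst (\<sigma> n)" and "b n = fst (snd (\<sigma> n))" and "c n = fst (snd (snd (\<sigma> n)))"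
    and "d n = fst (snd (snd (snd (\<sigma> n))))" and "p n = fst (snd (snd (snd (snd (\<sigma> n)))))"
    and "q n = snd (snd (snd (snd (snd (\<sigma> n)))))" for n
  have \<sigma>_eq: "\<sigma> n = (a n, b n, c n, d n, p n, q n)" for n
    by (simp add: a_def b_def c_def d_def p_def q_def)
  have bal: "(a n, b n) \<in> \<N>" "(c n, d n) \<in> \<N>" "p n \<in> {a n..b n}" "q n \<in> {c n..d n}"
    "f (p n, q n) = t" "\<alpha> * (b n - a n) \<le> r * (d n - c n)" for n
    using \<sigma>(1)[of n] nondegenerate[of "c n" "d n"] unfolding \<sigma>_eq balanced_def by (auto simp: field_simps)
  have nest: "a n \<le> a (Suc n)" "b (Suc n) \<le> b n" "c n \<le> c (Suc n)" "d (Suc n) \<le> d n"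
    "d (Suc n) - c (Suc n) \<le> (d n - c n) / 2" for n
    using \<sigma>(2)[of n] unfolding \<sigma>_eq nested_def by auto
  have "d n - c n \<le> (d 0 - c 0) * (1/2) ^ n" for n
  proof (induction n)
    case (Suc n)
    then show ?case
      using nest(5)[of n] by simp
  qed simp
  moreover have "(\<lambda>n. (d 0 - c 0) * (1/2) ^ n) \<longlonglongrightarrow> (d 0 - c 0) * 0"
    by (intro tendsto_intros LIMSEQ_power_zero) auto
  moreover have "0 \<le> d n - c n" for n
    using nondegenerate[OF bal(2)[of n]] by simp
  ultimately have dc: "(\<lambda>n. d n - c n) \<longlonglongrightarrow> 0"
    by (intro tendsto_sandwich[of "\<lambda>_. 0" "\<lambda>n. d n - c n" _ "\<lambda>n. (d 0 - c 0) * (1/2) ^ n"]) auto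
  have "(\<lambda>n. r / \<alpha> * (d n - c n)) \<longlonglongrightarrow> r / \<alpha> * 0"
    by (intro tendsto_intros dc)
  moreover have "b n - a n \<le> r / \<alpha> * (d n - c n)" for n
    using bal(6)[of n] \<alpha>_pos by (simp add: field_simps)
  moreover have "0 \<le> b n - a n" for n
    using nondegenerate[OF bal(1)[of n]] by simp
  ultimately have ba: "(\<lambda>n. b n - a n) \<longlonglongrightarrow> 0"
    by (intro tendsto_sandwich[of "\<lambda>_. 0" "\<lambda>n. b n - a n" _ "\<lambda>n. r / \<alpha> * (d n - c n)"]) auto
  have limit: "\<exists>y\<in>fine_points \<N>. z \<longlonglongrightarrow> y"
    if mono: "\<And>n. u n \<le> u (Suc n)" "\<And>n. v (Suc n) \<le> v n" "\<And>n. (u n, v n) \<in> \<N>"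
      "(\<lambda>n. v n - u n) \<longlonglongrightarrow> 0" "\<And>n. z n \<in> {u n..v n}" for u v z :: "nat \<Rightarrow> real"
  proof -
    have "\<forall>n. u n \<le> v n"
      using nondegenerate[OF that(3)] less_imp_le by blast
    moreover have "(\<lambda>n. u n - v n) \<longlonglongrightarrow> 0"
      using tendsto_minus[OF that(4)] by simp
    ultimately obtain y where y: "\<forall>n. u n \<le> y" "u \<longlonglongrightarrow> y" "\<forall>n. y \<le> v n" "v \<longlonglongrightarrow> y"
      using nested_sequence_unique[of u v] mono by blast
    have "\<exists>a b. (a, b) \<in> \<N> \<and> y \<in> {a..b} \<and> b - a < e" if e: "0 < e" for e
    proof -
      obtain n where "v n - u n < e"
        using order_tendstoD(2)[OF \<open>(\<lambda>n. v n - u n) \<longlonglongrightarrow> 0\<close> e]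
        by (auto simp: eventually_sequentially)
      then show ?thesis
        using y \<open>\<And>n. (u n, v n) \<in> \<N>\<close>[of n] by auto
    qed
    moreover have "z \<longlonglongrightarrow> y"
      using \<open>\<And>n. z n \<in> {u n..v n}\<close> y(2,4) by (intro tendsto_sandwich[of u z _ v]) auto
    ultimately show ?thesis
      by (auto simp: fine_points_def)
  qed
  obtain y where y: "y \<in> fine_points \<N>" "p \<longlonglongrightarrow> y"
    using limit[of a b p] nest bal ba by blast
  obtain z where z: "z \<in> fine_points \<N>" "q \<longlonglongrightarrow> z"
    using limit[of c d q] nest bal dc by blast
  have "isCont f (y, z)"
    using cont by (simp add: continuous_on_eq_continuous_at)
  then have "(\<lambda>n. f (p n, q n)) \<longlonglongrightarrow> f (y, z)"
    by (rule isCont_tendsto_compose) (intro tendsto_intros y z)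
  then have "f (y, z) = t"
    using bal(5) LIMSEQ_unique[of "\<lambda>n. t"] by simp
  then show ?thesis
    using y z by blast
qed

text \<open>Starting with the same interval in both coordinates, every value that \<open>f\<close> takes on the vertical
  segment above the midpoint, within the middle half, is taken on the Cantor set; these values fill
  an interval as \<open>f\<close> is continuous and injective there.\<close>

theorem image_contains_interval:
  assumes I: "(a, b) \<in> \<N>" and "\<alpha> \<le> r" "r \<le> 1"
  shows "\<exists>t0 t1. t0 < t1 \<and> {t0..t1} \<subseteq> {f (p, q) |p q. p \<in> fine_points \<N> \<and> q \<in> fine_points \<N>}"
proof -
  define l where "l = b - a"
  have l: "0 < l" "b = a + l"
    using nondegenerate[OF I] by (auto simp: l_def)
  define z where "z = a + l / 2"
  define g where "g q = f (z, q)" for q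
  have inS: "{a..b} \<subseteq> S"
    using inside[OF I] .
  have hit: "\<exists>p\<in>fine_points \<N>. \<exists>q\<in>fine_points \<N>. f (p, q) = g s"
    if "s \<in> {a + l / 4..a + 3 / 4 * l}" for s
  proof -
    have "balanced (g s) (a, b, a, b, z, s)"
      using that I assms(2,3) l mult_right_mono[OF assms(2), of l] mult_right_mono[OF assms(3), of l]
      by (auto simp: balanced_def g_def z_def)
    then show ?thesis
      by (rule balanced_value)
  qed
  have "m * \<bar>(a + l / 4) - (a + 3 / 4 * l)\<bar> \<le> \<bar>g (a + l / 4) - g (a + 3 / 4 * l)\<bar>"
    unfolding g_def using inS l by (intro snd_expand) (auto simp: z_def)
  moreover have "0 < m * \<bar>(a + l / 4) - (a + 3 / 4 * l)\<bar>"
    using m_pos l by simp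
  ultimately have ne: "g (a + l / 4) \<noteq> g (a + 3 / 4 * l)"
    by auto
  have cont_g: "continuous_on {a + l / 4..a + 3 / 4 * l} g"
    unfolding g_def by (intro continuous_on_compose2[OF cont] continuous_intros) auto
  define t0 t1 where "t0 = min (g (a + l / 4)) (g (a + 3 / 4 * l))"
    and "t1 = max (g (a + l / 4)) (g (a + 3 / 4 * l))"
  have "t0 < t1"
    using ne by (auto simp: t0_def t1_def)
  have "\<exists>p\<in>fine_points \<N>. \<exists>q\<in>fine_points \<N>. f (p, q) = t" if "t \<in> {t0..t1}" for t
  proof -
    have "\<exists>s. a + l / 4 \<le> s \<and> s \<le> a + 3 / 4 * l \<and> g s = t"
    proof (cases "g (a + l / 4) \<le> g (a + 3 / 4 * l)")
      case True
      then show ?thesis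
        using that IVT'[of g "a + l / 4" t "a + 3 / 4 * l"] cont_g l by (simp add: t0_def t1_def)
    next
      case False
      then show ?thesis
        using that IVT2'[of g "a + 3 / 4 * l" t "a + l / 4"] cont_g l by (simp add: t0_def t1_def)
    qed
    then show ?thesis
      using hit by auto
  qed
  then have "{t0..t1} \<subseteq> {f (p, q) |p q. p \<in> fine_points \<N> \<and> q \<in> fine_points \<N>}"
    by blast
  with \<open>t0 < t1\<close> show ?thesis
    by blast
qed

end

text \<open>The conditions on the family hold for small \<open>\<rho>\<close> since \<open>\<alpha>\<close> and \<open>\<beta>\<close> are of order \<open>\<rho>\<close> and \<open>h\<close> is of
  order \<open>\<rho>\<^sup>2\<close>. The constant \<open>442368 = 8 * 96 * 24\<^sup>2\<close> is the one for which \<open>8 * L * h * r\<close> equals \<open>\<alpha>\<^sup>2\<close>,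
  and \<open>3 * 10 ^ 8\<close> exceeds \<open>4 * 144 * 442368\<close>, which is what the first smallness condition asks for.\<close>

lemma scale_inequalities:
  fixes x L \<rho> :: real
  assumes x: "0 < x" "x \<le> 1" and L: "1 \<le> L" and \<rho>: "0 < \<rho>" "\<rho> \<le> 1" "\<rho> \<le> x ^ 4 / (3 * 10 ^ 8 * L\<^sup>2)"
  defines "\<alpha> \<equiv> x / 24 * \<rho>" and "\<beta> \<equiv> 48 / x * \<rho>" and "h \<equiv> 96 / x * \<rho>\<^sup>2" and "r \<equiv> x ^ 3 / (442368 * L)"
  shows "\<beta> \<le> 1/2" "4 * L * (\<beta> + h) \<le> r" "4 * L\<^sup>2 * (\<beta> + h) \<le> 1" "8 * L * h * r \<le> \<alpha>\<^sup>2" "\<alpha> \<le> r" "r \<le> 1" "0 < r"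
proof -
  have "\<rho>\<^sup>2 \<le> \<rho>"
    using \<rho> by (simp add: power2_eq_square mult_left_le)
  then have "h \<le> 96 / x * \<rho>"
    unfolding h_def using x by (intro mult_left_mono) auto
  then have "\<beta> + h \<le> 144 / x * \<rho>"
    by (simp add: \<beta>_def)
  also have "\<dots> \<le> 144 / x * (x ^ 4 / (3 * 10 ^ 8 * L\<^sup>2))"
    using x \<rho> by (intro mult_left_mono) auto
  also have "\<dots> = 144 / (3 * 10 ^ 8) * (x ^ 3 / L\<^sup>2)"
    using x by (simp add: power3_eq_cube power4_eq_xxxx)
  finally have sum: "\<beta> + h \<le> 144 / (3 * 10 ^ 8) * (x ^ 3 / L\<^sup>2)" .
  have x3: "x ^ 3 \<le> 1" "0 < x ^ 3"
    using x by (auto simp: power_le_one)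
  have "4 * L * (\<beta> + h) \<le> 4 * L * (144 / (3 * 10 ^ 8) * (x ^ 3 / L\<^sup>2))"
    using L sum by (intro mult_left_mono) auto
  also have "\<dots> = 576 / (3 * 10 ^ 8) * (x ^ 3 / L)"
    using L by (simp add: power2_eq_square)
  also have "\<dots> \<le> 1 / 442368 * (x ^ 3 / L)"
    using L x3 by (intro mult_right_mono) auto
  finally show "4 * L * (\<beta> + h) \<le> r"
    by (simp add: r_def)
  have "4 * L\<^sup>2 * (\<beta> + h) \<le> 4 * L\<^sup>2 * (144 / (3 * 10 ^ 8) * (x ^ 3 / L\<^sup>2))"
    using L sum by (intro mult_left_mono) auto
  also have "\<dots> = 576 / (3 * 10 ^ 8) * x ^ 3"
    using L by simp
  also have "\<dots> \<le> 1"
    using x3 by simp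
  finally show S2: "4 * L\<^sup>2 * (\<beta> + h) \<le> 1" .
  have h0: "0 \<le> h" "0 \<le> \<beta>"
    using x \<rho> by (auto simp: h_def \<beta>_def)
  have "1 * (\<beta> + h) \<le> L\<^sup>2 * (\<beta> + h)"
    using L h0 by (intro mult_right_mono one_le_power) auto
  then show "\<beta> \<le> 1/2"
    using S2 h0 by simp
  show "8 * L * h * r \<le> \<alpha>\<^sup>2"
    using x L by (simp add: h_def r_def \<alpha>_def power2_eq_square power3_eq_cube)
  show "0 < r"
    using x3 L by (simp add: r_def)
  have "r \<le> x ^ 3 / 1"
    unfolding r_def using x3 L by (intro divide_left_mono) auto
  then show "r \<le> 1"
    using x3 by simp
  have "\<alpha> \<le> \<beta>"
  proof -
    have "x \<le> 1 / x"
      using x by (simp add: field_simps mult_le_one)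
    then have "x / 24 \<le> 48 / x"
      using x by (simp add: field_simps)
    then show ?thesis
      unfolding \<alpha>_def \<beta>_def using \<rho> by (intro mult_right_mono) auto
  qed
  also have "\<beta> \<le> 4 * L * (\<beta> + h)"
  proof -
    have "1 * (\<beta> + h) \<le> 4 * L * (\<beta> + h)"
      using L h0 by (intro mult_right_mono) auto
    then show ?thesis
      using h0 by simp
  qed
  also have "\<dots> \<le> r"
    by fact
  finally show "\<alpha> \<le> r" .
qed

section \<open>Partial derivatives of continuously differentiable functions\<close>

lemma bilipschitz_of_derivative_bounds:
  fixes g g' :: "real \<Rightarrow> real"
  assumes "\<And>s. (g has_real_derivative g' s) (at s)" "\<And>s. s \<in> {c..d} \<Longrightarrow> m \<le> \<bar>g' s\<bar> \<and> \<bar>g' s\<bar> \<le> B"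
    and "s \<in> {c..d}" "s' \<in> {c..d}"
  shows "m * \<bar>s - s'\<bar> \<le> \<bar>g s - g s'\<bar> \<and> \<bar>g s - g s'\<bar> \<le> B * \<bar>s - s'\<bar>"
proof -
  have *: "m * \<bar>s - s'\<bar> \<le> \<bar>g s - g s'\<bar> \<and> \<bar>g s - g s'\<bar> \<le> B * \<bar>s - s'\<bar>"
    if less: "s < s'" and mem: "s \<in> {c..d}" "s' \<in> {c..d}" for s s'
  proof -
    obtain z where z: "s < z" "z < s'" "g s' - g s = (s' - s) * g' z"
      using MVT2[OF less, of g g'] assms(1) by blast
    then have "\<bar>g s - g s'\<bar> = \<bar>g' z\<bar> * \<bar>s - s'\<bar>"
      by (simp add: abs_minus_commute[of "g s"] abs_minus_commute[of s] abs_mult)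
    moreover have "m \<le> \<bar>g' z\<bar>" "\<bar>g' z\<bar> \<le> B"
      using assms(2)[of z] z mem by auto
    ultimately show ?thesis
      by (simp add: mult_right_mono)
  qed
  consider "s < s'" | "s = s'" | "s' < s"
    by linarith
  then show ?thesis
    using *[of s s'] *[of s' s] assms(3,4) by cases (simp_all add: abs_minus_commute)
qed

text \<open>The partial derivatives are the values of the total derivative at the two unit vectors, which
  depend continuously on the point.\<close>

lemma C1_partials:
  assumes "C1 f"
  shows "continuous_on UNIV f" "continuous_on UNIV (partial_fst f)" "continuous_on UNIV (partial_snd f)"
    "((\<lambda>s. f (s, q)) has_real_derivative partial_fst f (p, q)) (at p)"
    "((\<lambda>s. f (p, s)) has_real_derivative partial_snd f (p, q)) (at q)"
proof -
  obtain f' :: "real \<times> real \<Rightarrow> (real \<times> real) \<Rightarrow>\<^sub>L real" where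
    f': "\<And>z. (f has_derivative blinfun_apply (f' z)) (at z)" "continuous_on UNIV f'"
    using assms by (auto simp: C1_def)
  show "continuous_on UNIV f"
    using f'(1) by (meson has_derivative_continuous continuous_at_imp_continuous_on)
  have fst: "((\<lambda>s. f (s, q)) has_real_derivative f' (p, q) (1, 0)) (at p)" for p q
  proof -
    have "((\<lambda>s. (s, q)) has_derivative (\<lambda>s. (s, 0))) (at p)"
      by (auto intro!: derivative_eq_intros)
    from has_derivative_compose[OF this f'(1)]
    have deriv: "((\<lambda>s. f (s, q)) has_derivative (\<lambda>s. f' (p, q) (s, 0))) (at p)" .
    have "f' (p, q) (s, 0) = f' (p, q) (1, 0) * s" for s
      using blinfun.scaleR_right[of "f' (p, q)" s "(1, 0)"] by simp
    then have "(\<lambda>s. f' (p, q) (s, 0)) = (*) (f' (p, q) (1, 0))"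
      by (rule ext)
    with deriv show ?thesis
      unfolding has_field_derivative_def by (rule has_derivative_eq_rhs)
  qed
  have snd: "((\<lambda>s. f (p, s)) has_real_derivative f' (p, q) (0, 1)) (at q)" for p q
  proof -
    have "((\<lambda>s. (p, s)) has_derivative (\<lambda>s. (0, s))) (at q)"
      by (auto intro!: derivative_eq_intros)
    from has_derivative_compose[OF this f'(1)]
    have deriv: "((\<lambda>s. f (p, s)) has_derivative (\<lambda>s. f' (p, q) (0, s))) (at q)" .
    have "f' (p, q) (0, s) = f' (p, q) (0, 1) * s" for s
      using blinfun.scaleR_right[of "f' (p, q)" s "(0, 1)"] by simp
    then have "(\<lambda>s. f' (p, q) (0, s)) = (*) (f' (p, q) (0, 1))"
      by (rule ext)
    with deriv show ?thesis
      unfolding has_field_derivative_def by (rule has_derivative_eq_rhs)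
  qed
  have eq: "partial_fst f = (\<lambda>z. f' z (1, 0))" "partial_snd f = (\<lambda>z. f' z (0, 1))"
    using DERIV_imp_deriv[OF fst] DERIV_imp_deriv[OF snd] by (auto simp: partial_fst_def partial_snd_def)
  show "continuous_on UNIV (partial_fst f)" "continuous_on UNIV (partial_snd f)"
    unfolding eq by (intro continuous_intros f'(2))+
  show "((\<lambda>s. f (s, q)) has_real_derivative partial_fst f (p, q)) (at p)"
    "((\<lambda>s. f (p, s)) has_real_derivative partial_snd f (p, q)) (at q)"
    unfolding eq using fst snd by auto
qed

lemma nonzero_on_compact_bounds:
  fixes g :: "'a::topological_space \<Rightarrow> real"
  assumes "compact A" "A \<noteq> {}" "continuous_on A g" "\<And>z. z \<in> A \<Longrightarrow> g z \<noteq> 0"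
  shows "\<exists>m B. 0 < m \<and> (\<forall>z\<in>A. m \<le> \<bar>g z\<bar> \<and> \<bar>g z\<bar> \<le> B)"
proof -
  have cont: "continuous_on A (\<lambda>z. \<bar>g z\<bar>)"
    by (intro continuous_intros assms)
  obtain z1 where "z1 \<in> A" "\<forall>z\<in>A. \<bar>g z1\<bar> \<le> \<bar>g z\<bar>"
    using continuous_attains_inf[OF assms(1,2) cont] by blast
  moreover obtain z2 where "\<forall>z\<in>A. \<bar>g z\<bar> \<le> \<bar>g z2\<bar>"
    using continuous_attains_sup[OF assms(1,2) cont] by blast
  ultimately show ?thesis
    using assms(4) by (intro exI[of _ "\<bar>g z1\<bar>"] exI[of _ "\<bar>g z2\<bar>"]) auto
qed

text \<open>By compactness the partial derivatives are bounded and bounded away from zero on the square, and the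
  mean value theorem turns this into two-sided Lipschitz bounds on horizontal and vertical segments.\<close>

lemma C1_bilipschitz:
  assumes "C1 f" "c \<le> d" "\<And>z. z \<in> {c..d} \<times> {c..d} \<Longrightarrow> partial_fst f z \<noteq> 0 \<and> partial_snd f z \<noteq> 0"
  obtains m L where "0 < m" "1 \<le> L"
    "\<And>p p' q. p \<in> {c..d} \<Longrightarrow> p' \<in> {c..d} \<Longrightarrow> q \<in> {c..d} \<Longrightarrow>
       m * \<bar>p - p'\<bar> \<le> \<bar>f (p, q) - f (p', q)\<bar> \<and> \<bar>f (p, q) - f (p', q)\<bar> \<le> m * L * \<bar>p - p'\<bar>"
    "\<And>p q q'. p \<in> {c..d} \<Longrightarrow> q \<in> {c..d} \<Longrightarrow> q' \<in> {c..d} \<Longrightarrow>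
       m * \<bar>q - q'\<bar> \<le> \<bar>f (p, q) - f (p, q')\<bar> \<and> \<bar>f (p, q) - f (p, q')\<bar> \<le> m * L * \<bar>q - q'\<bar>"
proof -
  note C1 = C1_partials[OF assms(1)]
  define A where "A = {c..d} \<times> {c..d}"
  have A: "compact A" "A \<noteq> {}"
    using assms(2) by (auto simp: A_def compact_Times)
  have nz: "partial_fst f z \<noteq> 0" "partial_snd f z \<noteq> 0" if "z \<in> A" for z
    using assms(3)[of z] that by (auto simp: A_def)
  obtain m1 B1 where 1: "0 < m1" "\<And>z. z \<in> A \<Longrightarrow> m1 \<le> \<bar>partial_fst f z\<bar> \<and> \<bar>partial_fst f z\<bar> \<le> B1"
    using nonzero_on_compact_bounds[OF A continuous_on_subset[OF C1(2) subset_UNIV] nz(1)] by blast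
  obtain m2 B2 where 2: "0 < m2" "\<And>z. z \<in> A \<Longrightarrow> m2 \<le> \<bar>partial_snd f z\<bar> \<and> \<bar>partial_snd f z\<bar> \<le> B2"
    using nonzero_on_compact_bounds[OF A continuous_on_subset[OF C1(3) subset_UNIV] nz(2)] by blast
  define m where "m = min m1 m2"
  define L where "L = max 1 (max B1 B2 / m)"
  have m: "0 < m" "m \<le> m1" "m \<le> m2"
    using 1 2 by (auto simp: m_def)
  have "max B1 B2 = m * (max B1 B2 / m)"
    using m by simp
  also have "\<dots> \<le> m * L"
    using m by (intro mult_left_mono) (auto simp: L_def)
  finally have L: "B1 \<le> m * L" "B2 \<le> m * L"
    by auto
  show ?thesis
  proof (rule that[of m L])
    show "m * \<bar>p - p'\<bar> \<le> \<bar>f (p, q) - f (p', q)\<bar> \<and> \<bar>f (p, q) - f (p', q)\<bar> \<le> m * L * \<bar>p - p'\<bar>"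
      if "p \<in> {c..d}" "p' \<in> {c..d}" "q \<in> {c..d}" for p p' q
    proof (rule bilipschitz_of_derivative_bounds[OF C1(4)])
      show "m \<le> \<bar>partial_fst f (s, q)\<bar> \<and> \<bar>partial_fst f (s, q)\<bar> \<le> m * L" if "s \<in> {c..d}" for s
        using 1(2)[of "(s, q)"] that \<open>q \<in> {c..d}\<close> m L by (auto simp: A_def)
    qed (use that in auto)
    show "m * \<bar>q - q'\<bar> \<le> \<bar>f (p, q) - f (p, q')\<bar> \<and> \<bar>f (p, q) - f (p, q')\<bar> \<le> m * L * \<bar>q - q'\<bar>"
      if "p \<in> {c..d}" "q \<in> {c..d}" "q' \<in> {c..d}" for p q q'
    proof (rule bilipschitz_of_derivative_bounds[OF C1(5)])
      show "m \<le> \<bar>partial_snd f (p, s)\<bar> \<and> \<bar>partial_snd f (p, s)\<bar> \<le> m * L" if "s \<in> {c..d}" for s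
        using 2(2)[of "(p, s)"] that \<open>p \<in> {c..d}\<close> m L by (auto simp: A_def)
    qed (use that in auto)
  qed (use m in \<open>auto simp: L_def\<close>)
qed

section \<open>Remainders of expansions and forced digits\<close>

text \<open>If \<open>t\<close> has an expansion in base \<open>q\<close> that starts with the given word, then the remaining digits form
  an expansion of the remainder.\<close>

primrec remainder :: "real \<Rightarrow> real \<Rightarrow> nat list \<Rightarrow> real" where
  "remainder q t [] = t"
| "remainder q t (d # ds) = remainder q (q * t - real d) ds"

text \<open>The value of the expansion all of whose digits are \<open>M\<close>, hence the largest number that has an
  expansion. Reflecting all digits by \<open>d \<mapsto> M - d\<close> reflects values at half of it.\<close>

definition max_value :: "nat \<Rightarrow> real \<Rightarrow> real" where
  "max_value M q = real M / (q - 1)"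

text \<open>Replacing a digit by the next larger or smaller one changes the remainder by \<open>-1\<close> or \<open>+1\<close>. The
  conditions say that this takes the remainder out of the range of numbers that have expansions.\<close>

primrec forced :: "nat \<Rightarrow> real \<Rightarrow> real \<Rightarrow> nat list \<Rightarrow> bool" where
  "forced M q t [] = True"
| "forced M q t (d # ds) \<longleftrightarrow>
     (d < M \<longrightarrow> q * t - real d < 1) \<and> (0 < d \<longrightarrow> max_value M q - 1 < q * t - real d)
     \<and> forced M q (q * t - real d) ds"

lemma remainder_append: "remainder q t (u @ w) = remainder q (remainder q t u) w"
  by (induction u arbitrary: t) auto

lemma forced_append: "forced M q t (u @ w) \<longleftrightarrow> forced M q t u \<and> forced M q (remainder q t u) w"
  by (induction u arbitrary: t) auto

lemma continuous_on_remainder: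
  assumes "continuous_on A g"
  shows "continuous_on A (\<lambda>q. remainder q (g q) u)"
  using assms
proof (induction u arbitrary: g)
  case (Cons d u)
  then show ?case
    by (simp add: Cons.IH[of "\<lambda>q. q * g q - real d"] continuous_intros)
qed simp

lemma max_value_step: "1 < q \<Longrightarrow> max_value M q - (q * t - d) = q * (max_value M q - t) - (real M - d)"
  by (simp add: max_value_def field_simps)

lemma remainder_le: "0 < q \<Longrightarrow> remainder q t u \<le> q ^ length u * t"
proof (induction u arbitrary: t)
  case (Cons d u)
  have "remainder q t (d # u) \<le> q ^ length u * (q * t - real d)"
    using Cons.IH[of "q * t - real d"] Cons.prems by simp
  also have "\<dots> \<le> q ^ length u * (q * t)"
    using Cons.prems by (intro mult_left_mono) auto
  finally show ?case
    by (simp add: mult.assoc mult.left_commute)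
qed simp

lemma remainder_ge:
  "1 < q \<Longrightarrow> set u \<subseteq> {..M} \<Longrightarrow>
     max_value M q - remainder q t u \<le> q ^ length u * (max_value M q - t)"
proof (induction u arbitrary: t)
  case (Cons d u)
  have "max_value M q - (q * t - d) \<le> q * (max_value M q - t)"
    using max_value_step[of q M t d] Cons.prems by simp
  moreover have "max_value M q - remainder q t (d # u) \<le> q ^ length u * (max_value M q - (q * t - d))"
    using Cons.IH[of "q * t - real d"] Cons.prems by simp
  ultimately have "max_value M q - remainder q t (d # u) \<le> q ^ length u * (q * (max_value M q - t))"
    using Cons.prems by (elim order_trans) (intro mult_left_mono, auto)
  then show ?case
    by (simp add: mult.assoc mult.left_commute)
qed simp

text \<open>A single nonzero digit lowers the remainder by at least \<open>1\<close> against the word of zeros; the next lemma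
  is its mirror image. These two facts are the reason for excluding exactly the words that
  are constantly \<open>0\<close> or constantly \<open>M\<close> as blocks.\<close>

lemma remainder_le_strict:
  "1 < q \<Longrightarrow> \<exists>d\<in>set u. d \<noteq> 0 \<Longrightarrow> remainder q t u \<le> q ^ length u * t - 1"
proof (induction u arbitrary: t)
  case (Cons d u)
  have "remainder q t (d # u) \<le> q ^ length u * (q * t) - 1"
  proof (cases "d = 0")
    case True
    then show ?thesis
      using Cons.IH[of "q * t"] Cons.prems by simp
  next
    case False
    have "1 * 1 \<le> q ^ length u * real d"
      using Cons.prems False by (intro mult_mono) auto
    then show ?thesis
      using remainder_le[of q "q * t - real d" u] Cons.prems by (simp add: right_diff_distrib)
  qed
  then show ?case
    by (simp add: mult.assoc mult.left_commute)
qed simp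

lemma remainder_ge_strict:
  "1 < q \<Longrightarrow> set u \<subseteq> {..M} \<Longrightarrow> \<exists>d\<in>set u. d \<noteq> M \<Longrightarrow>
     max_value M q - remainder q t u \<le> q ^ length u * (max_value M q - t) - 1"
proof (induction u arbitrary: t)
  case (Cons d u)
  note step = max_value_step[of q M t d]
  have "max_value M q - remainder q t (d # u) \<le> q ^ length u * (q * (max_value M q - t)) - 1"
  proof (cases "d = M")
    case True
    then show ?thesis
      using Cons.IH[of "q * t - real M"] Cons.prems step by simp
  next
    case False
    then have "d < M"
      using Cons.prems by auto
    then have "1 * 1 \<le> q ^ length u * (real M - real d)"
      using Cons.prems by (intro mult_mono) auto
    then show ?thesis
      using remainder_ge[of q u M "q * t - real d"] Cons.prems step by (simp add: right_diff_distrib)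
  qed
  then show ?case
    by (simp add: mult.assoc mult.left_commute)
qed simp

text \<open>A remainder that is negative, or larger than the largest value, can never recover, so it suffices to
  control the last remainder.\<close>

lemma remainder_nonneg_prefix:
  assumes "0 < q" "0 \<le> remainder q t (u @ w)"
  shows "0 \<le> remainder q t u"
proof -
  have "q ^ length w * 0 \<le> q ^ length w * remainder q t u"
    using remainder_le[of q "remainder q t u" w] assms by (simp only: remainder_append) simp
  then show ?thesis
    by (rule mult_left_le_imp_le) (use assms(1) in simp)
qed

lemma remainder_le_max_prefix:
  assumes "1 < q" "set w \<subseteq> {..M}" "remainder q t (u @ w) \<le> max_value M q"
  shows "remainder q t u \<le> max_value M q"
proof -
  have "q ^ length w * 0 \<le> q ^ length w * (max_value M q - remainder q t u)"
    using remainder_ge[of q w M "remainder q t u"] assms by (simp only: remainder_append) simp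
  then have "0 \<le> max_value M q - remainder q t u"
    by (rule mult_left_le_imp_le) (use assms(1) in simp)
  then show ?thesis
    by simp
qed

lemma forcedI:
  assumes "\<And>v d w. u = v @ d # w \<Longrightarrow>
      max_value M q - 1 < remainder q t (v @ [d]) \<and> (d < M \<longrightarrow> remainder q t (v @ [d]) < 1)"
  shows "forced M q t u"
  using assms
proof (induction u rule: rev_induct)
  case (snoc e u)
  have "forced M q t u"
    by (rule snoc.IH) (use snoc.prems in auto)
  then show ?case
    using snoc.prems[of u e "[]"] by (auto simp: forced_append remainder_append)
qed simp

lemma is_expansion_bounds:
  assumes "is_expansion M q x d" "1 < q"
  shows "0 \<le> x" "x \<le> max_value M q"
proof -
  have s: "(\<lambda>i. real (d i) / q ^ Suc i) sums x" and d: "\<And>i. d i \<le> M"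
    using assms by (auto simp: is_expansion_def)
  show "0 \<le> x"
    using sums_le[OF _ sums_zero s] assms(2) by simp
  have "(\<lambda>i. (1 / q) ^ i) sums (1 / (1 - 1 / q))"
    using assms(2) by (intro geometric_sums) simp
  then have "(\<lambda>i. real M / q * (1 / q) ^ i) sums (real M / q * (1 / (1 - 1 / q)))"
    by (rule sums_mult)
  moreover have "real M / q * (1 / (1 - 1 / q)) = max_value M q"
    using assms(2) by (simp add: max_value_def field_simps)
  moreover have "real (d i) / q ^ Suc i \<le> real M / q * (1 / q) ^ i" for i
    using d[of i] assms(2) by (simp add: power_one_over divide_simps)
  ultimately show "x \<le> max_value M q"
    using sums_le[OF _ s] by metis
qed

lemma is_expansion_shift:
  assumes "is_expansion M q x d" "1 < q"
  shows "is_expansion M q (q * x - d 0) (\<lambda>i. d (Suc i))"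
proof -
  have "(\<lambda>i. real (d i) / q ^ Suc i) sums x"
    using assms by (simp add: is_expansion_def)
  then have "(\<lambda>i. real (d (Suc i)) / q ^ Suc (Suc i)) sums (x - d 0 / q)"
    by (subst sums_Suc_iff) simp
  then have "(\<lambda>i. q * (real (d (Suc i)) / q ^ Suc (Suc i))) sums (q * (x - d 0 / q))"
    by (rule sums_mult)
  then show ?thesis
    using assms by (simp add: is_expansion_def right_diff_distrib)
qed

text \<open>At the first digit that deviates from a forced word, the later digits would have to represent a
  number that is negative or larger than the largest value. Two expansions of \<open>x\<close> therefore agree on
  forced words.\<close>

lemma forced_expansion:
  assumes "forced M q x u" "is_expansion M q x d" "1 < q" "set u \<subseteq> {..M}" "i < length u"
  shows "d i = u ! i"
  using assms(1,2,4,5)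
proof (induction u arbitrary: x d i)
  case (Cons e u)
  note shift = is_expansion_shift[OF Cons.prems(2) assms(3)]
  note bounds = is_expansion_bounds[OF shift assms(3)]
  have "d 0 = e"
  proof (rule antisym)
    show "d 0 \<le> e"
    proof (rule ccontr)
      assume "\<not> d 0 \<le> e"
      moreover have "d 0 \<le> M"
        using Cons.prems(2) by (simp add: is_expansion_def)
      ultimately have "q * x - e < 1" "real e + 1 \<le> real (d 0)"
        using Cons.prems(1) by auto
      then show False
        using bounds(1) by simp
    qed
    show "e \<le> d 0"
    proof (rule ccontr)
      assume "\<not> e \<le> d 0"
      then have "max_value M q - 1 < q * x - e" "real (d 0) + 1 \<le> real e"
        using Cons.prems(1) by auto
      then show False
        using bounds(2) by simp
    qed
  qed
  moreover have "d (Suc j) = u ! j" if "j < length u" for j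
    using Cons.IH[OF _ shift] Cons.prems that \<open>d 0 = e\<close> by simp
  ultimately show ?case
    using Cons.prems(4) by (cases i) auto
qed simp

text \<open>Looking backwards from the end of a word, the distance of the remainder to either end of the range
  \<open>[0, M / (q - 1)]\<close> shrinks by at most a factor \<open>q\<close> per digit. A block that ends well inside the range
  therefore consists of forced digits, whatever they are.\<close>

lemma forced_block:
  assumes "1 < q" "set w \<subseteq> {..M}" "0 < \<theta>" "\<theta> \<le> remainder q t w" "remainder q t w \<le> 1 - \<theta>"
    and "1 \<le> max_value M q" "max_value M q - 1 < \<theta> / q ^ length w"
  shows "forced M q t w"
proof (rule forcedI)
  fix v d w' assume w: "w = v @ d # w'"
  define s where "s = remainder q t (v @ [d])"
  have rem: "remainder q t w = remainder q s w'"
    by (simp add: w s_def remainder_append)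
  have small: "q ^ length w' * (max_value M q - 1) < \<theta>"
  proof -
    have "q ^ length w' * (max_value M q - 1) \<le> q ^ length w * (max_value M q - 1)"
      using assms(1,6) by (intro mult_right_mono power_increasing) (auto simp: w)
    also have "\<dots> < \<theta>"
      using assms(1,7) by (simp add: field_simps)
    finally show ?thesis .
  qed
  have "q ^ length w' * (max_value M q - 1) < q ^ length w' * s"
    using small remainder_le[of q s w'] assms(1,4) rem by linarith
  then have "max_value M q - 1 < s"
    by (rule mult_left_less_imp_less) (use assms(1) in simp)
  moreover have "s < 1"
  proof -
    have "\<theta> \<le> max_value M q - remainder q s w'"
      using assms rem by simp
    also have "\<dots> \<le> q ^ length w' * (max_value M q - s)"
      using assms(1,2) by (intro remainder_ge) (auto simp: w)
    finally have "q ^ length w' * (max_value M q - 1) < q ^ length w' * (max_value M q - s)"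
      using small by linarith
    then have "max_value M q - 1 < max_value M q - s"
      by (rule mult_left_less_imp_less) (use assms(1) in simp)
    then show ?thesis
      by simp
  qed
  ultimately show "max_value M q - 1 < remainder q t (v @ [d]) \<and> (d < M \<longrightarrow> remainder q t (v @ [d]) < 1)"
    by (simp add: s_def)
qed

section \<open>Remainders as functions of the base\<close>

text \<open>The difference \<open>\<Delta>\<close> of the remainders for two bases \<open>p \<le> q\<close> changes with every further digit by the
  rule \<open>\<Delta>' = q * \<Delta> + (q - p) * s\<close>, where \<open>s\<close> is the previous remainder in base \<open>p\<close>. The remainder
  before the first digit is \<open>x\<close>, and the others only help as long as they are nonnegative. The remainder
  behind the last digit \<open>d\<close> is not among them and is allowed to be negative.\<close>

lemma remainder_diff_lower:
  assumes "0 < p" "p \<le> q" "0 \<le> x" "0 \<le> remainder p x u"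
  shows "q ^ length u * x * (q - p) \<le> remainder q x (u @ [d]) - remainder p x (u @ [d])"
  using assms(4)
proof (induction u arbitrary: d rule: rev_induct)
  case Nil
  then show ?case
    by (simp add: algebra_simps)
next
  case (snoc e u)
  have u: "0 \<le> remainder p x u"
    using remainder_nonneg_prefix[OF assms(1) snoc.prems] .
  have "q ^ length (u @ [e]) * x * (q - p) = q * (q ^ length u * x * (q - p))"
    by simp
  also have "\<dots> \<le> q * (remainder q x (u @ [e]) - remainder p x (u @ [e]))"
    using snoc.IH[OF u, of e] assms by (intro mult_left_mono) auto
  also have "\<dots> \<le> q * (remainder q x (u @ [e]) - remainder p x (u @ [e])) + (q - p) * remainder p x (u @ [e])"
    using assms snoc.prems by simp
  also have "\<dots> = remainder q x ((u @ [e]) @ [d]) - remainder p x ((u @ [e]) @ [d])"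
    by (simp add: remainder_append algebra_simps)
  finally show ?case .
qed

lemma remainder_mono:
  assumes "0 < p" "p \<le> q" "0 \<le> x" "0 \<le> remainder p x u"
  shows "remainder p x u \<le> remainder q x u"
proof (cases u rule: rev_cases)
  case (snoc v d)
  have "0 \<le> q ^ length v * x * (q - p)"
    using assms by simp
  also have "\<dots> \<le> remainder q x u - remainder p x u"
    unfolding snoc using assms snoc by (intro remainder_diff_lower remainder_nonneg_prefix[of p x v "[d]"]) auto
  finally show ?thesis by simp
qed simp

lemma remainder_diff_extend:
  assumes "0 < p" "p \<le> q" "0 \<le> remainder p x (u @ w)"
  shows "q ^ length w * (remainder q x u - remainder p x u) \<le> remainder q x (u @ w) - remainder p x (u @ w)"
  using assms(3)
proof (induction w rule: rev_induct)
  case (snoc e w)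
  have uw: "0 \<le> remainder p x (u @ w)"
    using remainder_nonneg_prefix[OF assms(1), of x "u @ w" "[e]"] snoc.prems by simp
  have "q ^ length (w @ [e]) * (remainder q x u - remainder p x u)
      = q * (q ^ length w * (remainder q x u - remainder p x u))"
    by simp
  also have "\<dots> \<le> q * (remainder q x (u @ w) - remainder p x (u @ w))"
    using snoc.IH[OF uw] assms by (intro mult_left_mono) auto
  also have "\<dots> \<le> q * (remainder q x (u @ w) - remainder p x (u @ w)) + (q - p) * remainder p x (u @ w)"
    using assms uw by simp
  also have "\<dots> = remainder q x (u @ w @ [e]) - remainder p x (u @ w @ [e])"
    by (simp add: remainder_append algebra_simps)
  finally show ?case .
qed simp

text \<open>The same recursion, with all remainders estimated by the largest value, gives a geometric sum.\<close>

lemma remainder_diff_upper: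
  assumes "1 < p" "p \<le> q" "set u \<subseteq> {..M}" "remainder p x u \<le> max_value M p"
  shows "remainder q x u - remainder p x u \<le> (q - p) * max_value M p * ((q ^ length u - 1) / (q - 1))"
  using assms(3,4)
proof (induction u rule: rev_induct)
  case (snoc e u)
  have u: "remainder p x u \<le> max_value M p"
    using remainder_le_max_prefix[of p "[e]" M x u] snoc.prems assms by simp
  have "remainder q x (u @ [e]) - remainder p x (u @ [e])
      = q * (remainder q x u - remainder p x u) + (q - p) * remainder p x u"
    by (simp add: remainder_append algebra_simps)
  also have "\<dots> \<le> q * ((q - p) * max_value M p * ((q ^ length u - 1) / (q - 1))) + (q - p) * max_value M p"
    using snoc.IH u snoc.prems assms by (intro add_mono mult_left_mono) auto
  also have "\<dots> = (q - p) * max_value M p * (q * ((q ^ length u - 1) / (q - 1)) + 1)"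
    by (simp add: distrib_left mult.left_commute mult.assoc)
  also have "q * ((q ^ length u - 1) / (q - 1)) + 1 = (q ^ length (u @ [e]) - 1) / (q - 1)"
    using assms by (simp add: field_simps)
  finally show ?case .
qed simp

section \<open>Quasi-greedy expansions\<close>

text \<open>The largest digit that leaves a positive remainder. In contrast to the greedy choice, this keeps
  remainders in \<open>(0, 1]\<close> for every base up to and including \<open>M + 1\<close>, and never produces a tail of
  zeros.\<close>

definition quasi_greedy_digit :: "real \<Rightarrow> real \<Rightarrow> nat" where
  "quasi_greedy_digit q t = nat (\<lceil>q * t\<rceil> - 1)"

primrec quasi_greedy_tail :: "real \<Rightarrow> real \<Rightarrow> nat \<Rightarrow> real" where
  "quasi_greedy_tail q x 0 = x"
| "quasi_greedy_tail q x (Suc n) =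
     q * quasi_greedy_tail q x n - quasi_greedy_digit q (quasi_greedy_tail q x n)"

definition quasi_greedy_word :: "real \<Rightarrow> real \<Rightarrow> nat \<Rightarrow> nat list" where
  "quasi_greedy_word q x n = map (\<lambda>i. quasi_greedy_digit q (quasi_greedy_tail q x i)) [0..<n]"

lemma quasi_greedy_digit:
  assumes "0 < q" "q \<le> real M + 1" "0 < t" "t \<le> 1"
  shows "quasi_greedy_digit q t \<le> M" "0 < q * t - quasi_greedy_digit q t" "q * t - quasi_greedy_digit q t \<le> 1"
proof -
  have "0 < q * t"
    using assms by simp
  then have pos: "1 \<le> \<lceil>q * t\<rceil>"
    by linarith
  have "q * t \<le> (real M + 1) * 1"
    using assms by (intro mult_mono) auto
  then have "\<lceil>q * t\<rceil> \<le> int M + 1"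
    by (simp add: ceiling_le_iff)
  then show "quasi_greedy_digit q t \<le> M"
    by (simp add: quasi_greedy_digit_def)
  have "real (quasi_greedy_digit q t) = of_int (\<lceil>q * t\<rceil> - 1)"
    using pos by (simp add: quasi_greedy_digit_def)
  then show "0 < q * t - quasi_greedy_digit q t" "q * t - quasi_greedy_digit q t \<le> 1"
    by linarith+
qed

lemma quasi_greedy_tail:
  assumes "0 < q" "q \<le> real M + 1" "0 < x" "x \<le> 1"
  shows "0 < quasi_greedy_tail q x n \<and> quasi_greedy_tail q x n \<le> 1"
  by (induction n) (use assms quasi_greedy_digit[OF assms(1,2)] in auto)

lemma length_quasi_greedy_word [simp]: "length (quasi_greedy_word q x n) = n"
  by (simp add: quasi_greedy_word_def)

lemma set_quasi_greedy_word:
  assumes "0 < q" "q \<le> real M + 1" "0 < x" "x \<le> 1"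
  shows "set (quasi_greedy_word q x n) \<subseteq> {..M}"
  using quasi_greedy_digit(1)[OF assms(1,2)] quasi_greedy_tail[OF assms] by (auto simp: quasi_greedy_word_def)

lemma remainder_quasi_greedy_word:
  "remainder q x (quasi_greedy_word q x n) = quasi_greedy_tail q x n"
  by (induction n) (auto simp: quasi_greedy_word_def remainder_append)

lemma quasi_greedy_prefix:
  assumes "quasi_greedy_word q x n = v @ w"
  shows "v = quasi_greedy_word q x (length v)"
proof -
  have "v = take (length v) (quasi_greedy_word q x n)"
    using assms by simp
  moreover have "length v \<le> n"
    using arg_cong[OF assms, of length] by simp
  ultimately show ?thesis
    by (simp add: quasi_greedy_word_def take_map min_def)
qed

lemma expansion_exists:
  assumes "1 < q" "q \<le> real M + 1" "0 < x" "x \<le> 1"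
  shows "\<exists>d. is_expansion M q x d"
proof -
  define t where "t = quasi_greedy_tail q x"
  define d where "d i = quasi_greedy_digit q (t i)" for i
  have t: "0 < t n" "t n \<le> 1" for n
    using quasi_greedy_tail[of q M x n] assms by (auto simp: t_def)
  have sum: "(\<Sum>i<n. real (d i) / q ^ Suc i) = x - t n * (1 / q) ^ n" for n
  proof (induction n)
    case (Suc n)
    have "t (Suc n) = q * t n - d n"
      by (simp add: t_def d_def)
    then have "t n * (1 / q) ^ n = t (Suc n) * (1 / q) ^ Suc n + d n / q ^ Suc n"
      using assms(1) by (simp add: field_simps)
    then show ?case
      using Suc.IH by (simp only: sum.lessThan_Suc)
  qed (simp add: t_def)
  have "(\<lambda>n. t n * (1 / q) ^ n) \<longlonglongrightarrow> 0"
  proof (rule tendsto_sandwich[of "\<lambda>_. 0" _ _ "\<lambda>n. (1 / q) ^ n"])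
    show "(\<lambda>n. (1 / q) ^ n) \<longlonglongrightarrow> 0"
      using assms(1) by (intro LIMSEQ_power_zero) simp
  qed (use t assms(1) in \<open>auto simp: less_imp_le mult_le_cancel_right2\<close>)
  then have "(\<lambda>n. x - t n * (1 / q) ^ n) \<longlonglongrightarrow> x - 0"
    by (intro tendsto_intros)
  then have "(\<lambda>i. real (d i) / q ^ Suc i) sums x"
    by (simp only: sums_def sum) simp
  moreover have "d i \<le> M" for i
    unfolding d_def using quasi_greedy_digit(1)[of q M "t i"] t[of i] assms by simp
  ultimately show ?thesis
    by (auto simp: is_expansion_def)
qed

text \<open>As long as the remainder is below \<open>1 / q\<close> the digit is \<open>0\<close> and the remainder is multiplied by \<open>q\<close>, so it
  cannot stay there forever.\<close>

lemma quasi_greedy_tail_large: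
  assumes "1 < q" "q \<le> real M + 1" "0 < x" "x \<le> 1"
  shows "\<exists>N\<ge>n. 1 / q \<le> quasi_greedy_tail q x N"
proof (rule ccontr)
  assume "\<not> ?thesis"
  then have "quasi_greedy_tail q x (n + k) < 1 / q" for k
    using not_le le_add1[of n k] by blast
  then have small: "q * quasi_greedy_tail q x (n + k) < 1" for k
    using assms(1) by (simp add: less_divide_eq mult.commute)
  have pos: "0 < quasi_greedy_tail q x k" for k
    using quasi_greedy_tail[of q M x k] assms by simp
  have grow: "quasi_greedy_tail q x (n + k) = q ^ k * quasi_greedy_tail q x n" for k
  proof (induction k)
    case (Suc k)
    have "0 < q * quasi_greedy_tail q x (n + k)"
      using pos assms(1) by simp
    then have "\<lceil>q * quasi_greedy_tail q x (n + k)\<rceil> = 1"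
      using small[of k] by (simp add: ceiling_eq_iff)
    then show ?case
      using Suc by (simp add: quasi_greedy_digit_def)
  qed simp
  obtain k where "1 / quasi_greedy_tail q x n < q ^ k"
    using real_arch_pow[OF assms(1)] by blast
  then have "1 < q ^ k * quasi_greedy_tail q x n"
    using pos[of n] by (simp add: divide_less_eq)
  then have "1 < quasi_greedy_tail q x (n + k)"
    by (simp only: grow)
  moreover have "quasi_greedy_tail q x (n + k) \<le> 1"
    using quasi_greedy_tail[of q M x] assms by simp
  ultimately show False
    by simp
qed

section \<open>Intervals of bases with prescribed digits\<close>

text \<open>The window of bases is \<open>[q0, M + 1)\<close>. The assumption \<open>overlap\<close> makes the blocks forced, \<open>pow_K\<close> says
  that \<open>q ^ K\<close> hardly differs from \<open>(M + 1) ^ K\<close> throughout the window, and \<open>long\<close> is used for words so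
  long that \<open>q ^ length u\<close> is constant up to a factor \<open>2\<close> on the interval of bases that belongs to
  \<open>u\<close>; all later constants thus depend on \<open>x\<close> only.\<close>

locale base_window =
  fixes M K m0 :: nat and x \<rho> q0 :: real
  assumes M: "1 \<le> M" and K: "2 \<le> K" and x: "0 < x" "x \<le> 1"
    and \<rho>: "\<rho> = 1 / (real M + 1) ^ K" and \<rho>_le: "\<rho> \<le> 1/4"
    and q0: "real M + 1/2 \<le> q0"
    and overlap: "\<And>q. q0 \<le> q \<Longrightarrow> q < real M + 1 \<Longrightarrow> max_value M q - 1 < \<rho>\<^sup>2"
    and pow_K: "\<And>q. q0 \<le> q \<Longrightarrow> q < real M + 1 \<Longrightarrow> 1 - \<rho> \<le> q ^ K * \<rho>"
    and long: "\<And>m q. m0 \<le> m \<Longrightarrow> 3/2 \<le> q \<Longrightarrow> 2 * real m \<le> x * q ^ m"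
begin

text \<open>The word \<open>u\<close> starts an expansion of \<open>x\<close> in every base between \<open>a\<close> and \<open>b\<close>, and the endpoints are the
  bases for which its remainder is \<open>\<rho>\<close> and \<open>1 - \<rho>\<close>. That the digits are forced is part of the
  definition so that it is inherited by subintervals and only the digits of the last block need an argument.\<close>

definition node :: "nat list \<Rightarrow> real \<Rightarrow> real \<Rightarrow> bool" where
  "node u a b \<longleftrightarrow> m0 \<le> length u \<and> u \<noteq> [] \<and> set u \<subseteq> {..M} \<and> q0 \<le> a \<and> a < b \<and> b < real M + 1
     \<and> remainder a x u = \<rho> \<and> remainder b x u = 1 - \<rho> \<and> (\<forall>p\<in>{a..b}. forced M p x u)"

definition node_intervals :: "(real \<times> real) set" where
  "node_intervals = {(a, b). \<exists>u. node u a b}"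

lemma \<rho>_pos: "0 < \<rho>"
  by (simp add: \<rho>)

lemma window:
  assumes "q0 \<le> q" "q < real M + 1"
  shows "3/2 \<le> q" "1 \<le> max_value M q" "max_value M q \<le> 2" "1 / (2 * \<rho>) \<le> q ^ K" "q ^ K * \<rho> \<le> 1"
proof -
  show "3/2 \<le> q"
    using q0 M assms by simp
  then have "0 < q - 1"
    by simp
  moreover have "real M \<le> 2 * (q - 1)" "q - 1 \<le> real M"
    using q0 M assms by auto
  ultimately show "1 \<le> max_value M q" "max_value M q \<le> 2"
    by (simp_all add: max_value_def divide_le_eq le_divide_eq)
  show "1 / (2 * \<rho>) \<le> q ^ K"
    using pow_K[OF assms] \<rho>_le \<rho>_pos by (simp add: field_simps)
  have "q ^ K \<le> (real M + 1) ^ K"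
    using assms \<open>3/2 \<le> q\<close> by (intro power_mono) auto
  then show "q ^ K * \<rho> \<le> 1"
    by (simp add: \<rho>)
qed

lemma forced_word:
  assumes "q0 \<le> p" "p < real M + 1" "length w = K" "set w \<subseteq> {..M}"
    and "\<rho> \<le> remainder p t w" "remainder p t w \<le> 1 - \<rho>"
  shows "forced M p t w"
proof (rule forced_block[where \<theta> = \<rho>])
  note wp = window[OF assms(1,2)]
  show "1 < p" "1 \<le> max_value M p"
    using wp by auto
  have "p ^ K * (max_value M p - 1) < p ^ K * \<rho>\<^sup>2"
    using overlap[OF assms(1,2)] wp by simp
  also have "\<dots> = (p ^ K * \<rho>) * \<rho>"
    by (simp add: power2_eq_square)
  also have "\<dots> \<le> 1 * \<rho>"
    using wp \<rho>_pos by (intro mult_right_mono) auto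
  finally show "max_value M p - 1 < \<rho> / p ^ length w"
    using wp assms(3) by (simp add: field_simps)
qed (use assms \<rho>_pos in auto)

text \<open>The remainder runs from \<open>\<rho>\<close> to \<open>1 - \<rho>\<close>, that is through a length between \<open>1/2\<close> and \<open>1\<close>, while its
  slope in \<open>q\<close> is \<open>b ^ (length u - 1)\<close> up to constant factors.\<close>

lemma node_size:
  assumes "node u a b"
  shows "x * b ^ length u * (b - a) \<le> b" "b \<le> 12 * (b ^ length u * (b - a))"
proof -
  have u: "u \<noteq> []" "set u \<subseteq> {..M}" and ab: "q0 \<le> a" "a < b" "b < real M + 1"
    and rem: "remainder a x u = \<rho>" "remainder b x u = 1 - \<rho>"
    using assms by (auto simp: node_def)
  note wa = window[of a] and wb = window[of b]
  obtain v d where v: "u = v @ [d]"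
    using u(1) by (cases u rule: rev_cases) auto
  have "0 \<le> remainder a x v"
    using remainder_nonneg_prefix[of a x v "[d]"] wa ab rem \<rho>_pos v by simp
  then have "b ^ length v * x * (b - a) \<le> (1 - \<rho>) - \<rho>"
    using remainder_diff_lower[of a b x v d] wa ab rem x v by simp
  also have "\<dots> \<le> 1"
    using \<rho>_pos by simp
  finally have "b * (b ^ length v * x * (b - a)) \<le> b * 1"
    using wb ab by (intro mult_left_mono) auto
  then show "x * b ^ length u * (b - a) \<le> b"
    by (simp add: v mult_ac)
  have "(1 - \<rho>) - \<rho> \<le> (b - a) * max_value M a * ((b ^ length u - 1) / (b - 1))"
    using remainder_diff_upper[of a b u M x] wa ab rem u \<rho>_le by simp
  also have "\<dots> \<le> (b - a) * 2 * (b ^ length u / (b - 1))"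
    using wa wb ab by (intro mult_mono divide_right_mono) auto
  finally have "(1 - 2 * \<rho>) * (b - 1) \<le> 2 * (b ^ length u * (b - a))"
    using wb ab by (simp add: field_simps)
  moreover have "1/2 * (b / 3) \<le> (1 - 2 * \<rho>) * (b - 1)"
    using wb ab \<rho>_le by (intro mult_mono) auto
  ultimately show "b \<le> 12 * (b ^ length u * (b - a))"
    by simp
qed

text \<open>By Bernoulli's inequality it is enough that \<open>length u * (b - a)\<close> is at most \<open>b / 2\<close>, which holds because
  \<open>b - a\<close> is exponentially small in the length of \<open>u\<close>.\<close>

lemma node_distortion:
  assumes "node u a b" "q \<in> {a..b}"
  shows "b ^ length u \<le> 2 * q ^ length u"
proof -
  define m where "m = length u"
  have ab: "q0 \<le> a" "a < b" "b < real M + 1" "m0 \<le> m"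
    using assms by (auto simp: node_def m_def)
  note wa = window[of a] and wb = window[of b]
  have b: "0 < b" "0 \<le> a"
    using wb wa ab by auto
  have "2 * real m * (b - a) \<le> x * b ^ m * (b - a)"
    using long[of m b] ab wb by (intro mult_right_mono) auto
  also have "\<dots> \<le> b"
    using node_size(1)[OF assms(1)] by (simp add: m_def)
  finally have "2 * real m * (b - a) \<le> b" .
  moreover have "real m * (b - q) \<le> real m * (b - a)"
    using assms(2) by (intro mult_left_mono) auto
  ultimately have "1/2 \<le> 1 + real m * (q / b - 1)"
    using b by (simp add: field_simps)
  also have "\<dots> \<le> (1 + (q / b - 1)) ^ m"
    using assms(2) b by (intro Bernoulli_inequality) simp
  finally show ?thesis
    using b by (simp add: power_divide field_simps m_def)
qed

lemma node_remainder:
  assumes "node u a b" "p \<in> {a..b}"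
  shows "\<rho> \<le> remainder p x u" "remainder p x u \<le> 1 - \<rho>"
proof -
  have ab: "q0 \<le> a" "a < b" "b < real M + 1"
    and rem: "remainder a x u = \<rho>" "remainder b x u = 1 - \<rho>"
    using assms(1) by (auto simp: node_def)
  have p: "0 < a" "0 < p"
    using window(1)[of a] ab assms(2) by auto
  show 1: "\<rho> \<le> remainder p x u"
    using remainder_mono[of a p x u] p assms(2) rem x \<rho>_pos by simp
  show "remainder p x u \<le> 1 - \<rho>"
    using remainder_mono[of p b x u] p assms(2) rem x \<rho>_pos 1 by simp
qed

text \<open>At the left endpoint of the interval of \<open>u\<close> the remainder behind \<open>u @ w\<close> is at most \<open>\<rho>\<close>, as \<open>w\<close> has
  a nonzero digit, and at the right endpoint it is at least \<open>1 - \<rho>\<close>, as \<open>w\<close> has a digit other than \<open>M\<close>.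
  Hence the intermediate value theorem finds the interval of \<open>u @ w\<close> inside.\<close>

lemma node_child:
  assumes "node u a b" "length w = K" "set w \<subseteq> {..M}" "\<exists>d\<in>set w. d \<noteq> 0" "\<exists>d\<in>set w. d \<noteq> M"
  shows "\<exists>a' b'. node (u @ w) a' b' \<and> a \<le> a' \<and> b' \<le> b"
proof -
  have u: "u \<noteq> []" "set u \<subseteq> {..M}" "m0 \<le> length u" and ab: "q0 \<le> a" "a < b" "b < real M + 1"
    and rem: "remainder a x u = \<rho>" "remainder b x u = 1 - \<rho>"
    and forced: "\<And>p. p \<in> {a..b} \<Longrightarrow> forced M p x u"
    using assms(1) by (auto simp: node_def)
  note wa = window[of a] and wb = window[of b]
  have low: "remainder a x (u @ w) \<le> \<rho>"
    using remainder_le_strict[of a w \<rho>] assms(2,4) wa ab rem \<rho>_pos by (simp add: remainder_append)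
  have high: "1 - \<rho> \<le> remainder b x (u @ w)"
  proof -
    have "max_value M b - remainder b (1 - \<rho>) w \<le> b ^ K * (max_value M b - 1 + \<rho>) - 1"
      using remainder_ge_strict[of b w M "1 - \<rho>"] assms wb ab by (simp add: algebra_simps)
    also have "b ^ K * (max_value M b - 1 + \<rho>) \<le> b ^ K * \<rho>\<^sup>2 + b ^ K * \<rho>"
      using overlap[of b] ab wb by (simp add: distrib_left[symmetric])
    also have "b ^ K * \<rho>\<^sup>2 = (b ^ K * \<rho>) * \<rho>"
      by (simp add: power2_eq_square)
    also have "(b ^ K * \<rho>) * \<rho> + b ^ K * \<rho> \<le> 1 * \<rho> + 1"
      using wb ab \<rho>_pos by (intro add_mono mult_right_mono) auto
    finally show ?thesis
      using wb ab rem by (simp add: remainder_append)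
  qed
  have cont: "continuous_on A (\<lambda>q. remainder q x (u @ w))" for A
    by (intro continuous_on_remainder continuous_intros)
  obtain a' where a': "a \<le> a'" "a' \<le> b" "remainder a' x (u @ w) = \<rho>"
    using IVT'[of "\<lambda>q. remainder q x (u @ w)" a \<rho> b] low high ab \<rho>_le cont by auto
  obtain b' where b': "a' \<le> b'" "b' \<le> b" "remainder b' x (u @ w) = 1 - \<rho>"
    using IVT'[of "\<lambda>q. remainder q x (u @ w)" a' "1 - \<rho>" b] a' high \<rho>_le cont by auto
  have "a' \<noteq> b'"
    using a' b' \<rho>_le by auto
  have "forced M p x (u @ w)" if p: "p \<in> {a'..b'}" for p
  proof -
    have win: "q0 \<le> p" "p < real M + 1"
      using p a' b' ab by auto
    have a'0: "0 < a'"
      using wa ab a' by auto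
    have 1: "\<rho> \<le> remainder p x (u @ w)"
      using remainder_mono[of a' p x "u @ w"] a' p x \<rho>_pos a'0 by simp
    then have 2: "remainder p x (u @ w) \<le> 1 - \<rho>"
      using remainder_mono[of p b' x "u @ w"] b' p x \<rho>_pos a'0 by simp
    have "forced M p (remainder p x u) w"
      using forced_word[OF win assms(2,3)] 1 2 by (simp add: remainder_append)
    moreover have "forced M p x u"
      using p a' b' by (intro forced) auto
    ultimately show ?thesis
      by (simp add: forced_append)
  qed
  then have "node (u @ w) a' b'"
    using u ab assms(3) a' b' \<open>a' \<noteq> b'\<close> by (auto simp: node_def)
  then show ?thesis
    using a' b' by blast
qed

text \<open>The first \<open>K\<close> quasi-greedy digits have a remainder in \<open>[0, 1]\<close>. If they happen to be constantly \<open>0\<close>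
  or \<open>M\<close>, changing the last digit gives an admissible block, and the remainder leaves \<open>[0, 1]\<close> by no
  more than \<open>\<rho>\<close>, because \<open>t\<close> itself is at least \<open>\<rho>\<close> away from \<open>0\<close> and \<open>1\<close>. Only the last remainder can
  become negative in this way, not the one before it.\<close>

lemma near_word:
  assumes "q0 \<le> p" "p < real M + 1" "\<rho> \<le> t" "t \<le> 1 - \<rho>"
  shows "\<exists>v d. length (v @ [d]) = K \<and> set (v @ [d]) \<subseteq> {..M} \<and> (\<exists>e\<in>set (v @ [d]). e \<noteq> 0)
    \<and> (\<exists>e\<in>set (v @ [d]). e \<noteq> M) \<and> 0 \<le> remainder p t v
    \<and> - \<rho> \<le> remainder p t (v @ [d]) \<and> remainder p t (v @ [d]) \<le> 1 + \<rho>"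
proof -
  note wp = window[OF assms(1,2)]
  have p: "0 < p" "p \<le> real M + 1" "1 < p"
    using wp assms(2) by auto
  have t: "0 < t" "t \<le> 1"
    using assms(3,4) \<rho>_pos by auto
  define w where "w = quasi_greedy_word p t K"
  have w: "length w = K" "set w \<subseteq> {..M}" "0 < remainder p t w" "remainder p t w \<le> 1"
    using set_quasi_greedy_word[OF p(1,2) t] quasi_greedy_tail[OF p(1,2) t, of K]
    by (auto simp: w_def remainder_quasi_greedy_word)
  obtain v d where vd: "w = v @ [d]"
    using w(1) K by (cases w rule: rev_cases) auto
  have v: "0 \<le> remainder p t v"
    using remainder_nonneg_prefix[of p t v "[d]"] p w(3) vd by simp
  have "v \<noteq> []"
    using w(1) K vd by auto
  consider "\<forall>e\<in>set w. e = 0" | "\<forall>e\<in>set w. e = M" | "(\<exists>e\<in>set w. e \<noteq> 0) \<and> (\<exists>e\<in>set w. e \<noteq> M)"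
    by blast
  then show ?thesis
  proof cases
    case 1
    have zero: "remainder p t w' = p ^ length w' * t" if "\<forall>e\<in>set w'. e = 0" for w' t
      using that by (induction w' arbitrary: t) (auto simp: mult_ac)
    have "1 - \<rho> \<le> p ^ K * \<rho>"
      using pow_K[OF assms(1,2)] .
    also have "\<dots> \<le> p ^ K * t"
      using assms(3) p by (intro mult_left_mono) auto
    also have "\<dots> = remainder p t w"
      using zero[OF 1, of t] w(1) by simp
    finally have "- \<rho> \<le> remainder p t (v @ [1])"
      using vd 1 by (simp add: remainder_append)
    moreover have "remainder p t (v @ [1]) \<le> 1 + \<rho>"
      using vd w(4) \<rho>_pos 1 by (simp add: remainder_append)
    moreover have "\<exists>e\<in>set (v @ [1]). e \<noteq> M"
      using \<open>v \<noteq> []\<close> 1 vd M by (cases v) auto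
    ultimately show ?thesis
      using w vd v M by (intro exI[of _ v] exI[of _ 1]) auto
  next
    case 2
    have full: "max_value M p - remainder p t w' = p ^ length w' * (max_value M p - t)"
      if "\<forall>e\<in>set w'. e = M" for w' t
      using that max_value_step[OF p(3), of M t "real M" for t]
      by (induction w' arbitrary: t) (auto simp: mult_ac)
    have "p ^ K * \<rho> + 1 * (max_value M p - 1) \<le> p ^ K * (max_value M p - t)"
    proof -
      have "p ^ K * \<rho> + 1 * (max_value M p - 1) \<le> p ^ K * \<rho> + p ^ K * (max_value M p - 1)"
        using wp p \<rho>_pos by (intro add_mono mult_right_mono one_le_power) auto
      also have "\<dots> = p ^ K * (max_value M p - (1 - \<rho>))"
        by (simp add: algebra_simps)
      also have "\<dots> \<le> p ^ K * (max_value M p - t)"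
        using assms(4) p by (intro mult_left_mono) auto
      finally show ?thesis .
    qed
    then have "remainder p t w \<le> \<rho>"
      using full[OF 2, of t] w(1) pow_K[OF assms(1,2)] by simp
    then have "remainder p t (v @ [M - 1]) \<le> 1 + \<rho>"
      using vd 2 M by (simp add: remainder_append of_nat_diff)
    moreover have "- \<rho> \<le> remainder p t (v @ [M - 1])"
      using vd 2 M w(3) \<rho>_pos by (simp add: remainder_append of_nat_diff)
    moreover have "\<exists>e\<in>set (v @ [M - 1]). e \<noteq> 0"
      using \<open>v \<noteq> []\<close> 2 vd M by (cases v) auto
    ultimately show ?thesis
      using w vd v M by (intro exI[of _ v] exI[of _ "M - 1"]) auto
  next
    case 3
    then show ?thesis
      using w vd v \<rho>_pos by (intro exI[of _ v] exI[of _ d]) auto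
  qed
qed

text \<open>The subinterval belongs to the block of the preceding lemma. The point \<open>p\<close> can miss it only by as much
  as its remainder misses \<open>[\<rho>, 1 - \<rho>]\<close>, which is at most \<open>2 * \<rho>\<close>, divided by a slope of order
  \<open>b ^ length u / \<rho>\<close>. This is the source of the factor \<open>\<rho>\<^sup>2\<close>.\<close>

lemma node_refine:
  assumes node: "node u a b" and p: "p \<in> {a..b}"
  shows "\<exists>u' a' b' p'. node u' a' b' \<and> a \<le> a' \<and> b' \<le> b
    \<and> x / 24 * \<rho> * (b - a) \<le> b' - a' \<and> b' - a' \<le> 48 / x * \<rho> * (b - a)
    \<and> p' \<in> {a'..b'} \<and> \<bar>p' - p\<bar> \<le> 96 / x * \<rho>\<^sup>2 * (b - a)"
proof -
  define m where "m = length u"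
  have ab: "q0 \<le> a" "a < b" "b < real M + 1"
    using node by (auto simp: node_def)
  have win: "q0 \<le> p" "p < real M + 1"
    using ab p by auto
  note rem = node_remainder[OF node p]
  obtain v d where w: "length (v @ [d]) = K" "set (v @ [d]) \<subseteq> {..M}" "\<exists>e\<in>set (v @ [d]). e \<noteq> 0"
      "\<exists>e\<in>set (v @ [d]). e \<noteq> M" "0 \<le> remainder p x (u @ v)"
      "- \<rho> \<le> remainder p x (u @ v @ [d])" "remainder p x (u @ v @ [d]) \<le> 1 + \<rho>"
    using near_word[OF win rem] by (auto simp: remainder_append)
  define u' where "u' = u @ v @ [d]"
  have len: "length u' = m + K" "length (u @ v) = m + K - 1"
    using w(1) by (auto simp: u'_def m_def)
  obtain a' b' where child: "node u' a' b'" "a \<le> a'" "b' \<le> b"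
    using node_child[OF node w(1-4)] by (auto simp: u'_def)
  have ab': "a' < b'" and rem': "remainder a' x u' = \<rho>" "remainder b' x u' = 1 - \<rho>"
    using child(1) by (auto simp: node_def)
  have pow: "b ^ m \<le> 2 * q ^ m" if "q \<in> {a..b}" for q
    using node_distortion[OF node that] by (simp add: m_def)
  have wab: "q0 \<le> q" "q < real M + 1" if "q \<in> {a..b}" for q
    using that ab by auto
  have b'_mem: "b' \<in> {a..b}"
    using child ab' by auto
  note wb' = window[OF wab[OF b'_mem]]
  have bpos: "0 < b ^ m" "0 < b" "0 < b' ^ m" "0 < b' ^ K"
    using wb' child(3) by auto
  have l: "0 < b - a" "0 < b' - a'"
    using ab ab' by auto
  have size: "x * b ^ m * (b - a) \<le> b" "b \<le> 12 * (b ^ m * (b - a))"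
    using node_size[OF node] by (auto simp: m_def)
  have size': "x * (b' ^ m * b' ^ K) * (b' - a') \<le> b'" "b' \<le> 12 * (b' ^ m * b' ^ K * (b' - a'))"
    using node_size[OF child(1)] by (simp_all only: len power_add)
  \<comment> \<open>Converts a bound relative to the length of \<open>u\<close> extended by a block into a multiple of \<open>\<rho> * (b - a)\<close>. It serves for the length of the subinterval and for the gap.\<close>
  have scale: "z \<le> 2 * c / x * \<rho> * (b - a)"
    if "q \<in> {a..b}" "x * (q ^ m * q ^ K) * z \<le> c / 24 * b" "0 \<le> z" "0 \<le> c" for q z c
  proof -
    note wq = window[OF wab[OF that(1)]]
    have "b ^ m * (x * z) * (1 / (2 * \<rho>)) \<le> (2 * q ^ m) * (x * z) * q ^ K"
      using pow[OF that(1)] wq x that(3) \<rho>_pos bpos by (intro mult_mono) auto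
    also have "\<dots> \<le> 2 * (c / 24 * b)"
      using that(2) by (simp add: mult_ac)
    also have "\<dots> \<le> 2 * (c / 24 * (12 * (b ^ m * (b - a))))"
      using size(2) that(4) by (intro mult_left_mono) auto
    also have "\<dots> = b ^ m * (c * (b - a))"
      by simp
    finally have "b ^ m * ((x * z) * (1 / (2 * \<rho>))) \<le> b ^ m * (c * (b - a))"
      by (simp only: mult.assoc)
    then have "(x * z) * (1 / (2 * \<rho>)) \<le> c * (b - a)"
      by (rule mult_left_le_imp_le) (rule bpos)
    then show ?thesis
      using x \<rho>_pos by (simp add: field_simps)
  qed
  have "b' - a' \<le> 2 * 24 / x * \<rho> * (b - a)"
    using size' child(3) l by (intro scale[OF b'_mem]) auto
  moreover have "x / 24 * \<rho> * (b - a) \<le> b' - a'"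
  proof -
    have "b \<le> 2 * b'"
      using b'_mem wab[OF b'_mem] ab q0 M by auto
    then have "x * b ^ m * (b - a) \<le> 2 * b'"
      using size(1) by linarith
    also have "\<dots> \<le> 24 * (b' ^ m * b' ^ K * (b' - a'))"
      using size'(2) by linarith
    also have "\<dots> \<le> 24 * (b ^ m * (1 / \<rho>) * (b' - a'))"
    proof (intro mult_left_mono mult_right_mono mult_mono)
      show "b' ^ m \<le> b ^ m"
        using child(3) wb' by (intro power_mono) auto
      show "b' ^ K \<le> 1 / \<rho>"
        using wb'(5) \<rho>_pos by (simp add: field_simps)
    qed (use bpos l in auto)
    finally have "b ^ m * (x * (b - a)) \<le> b ^ m * (24 * (1 / \<rho>) * (b' - a'))"
      by (simp only: mult_ac)
    then have "x * (b - a) \<le> 24 * (1 / \<rho>) * (b' - a')"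
      by (rule mult_left_le_imp_le) (rule bpos)
    then show ?thesis
      using \<rho>_pos by (simp add: field_simps)
  qed
  moreover have "\<exists>p'\<in>{a'..b'}. \<bar>p' - p\<bar> \<le> 2 * (48 * \<rho>) / x * \<rho> * (b - a)"
  proof -
    have gap: "z2 - z1 \<le> 2 * (48 * \<rho>) / x * \<rho> * (b - a)"
      if "a \<le> z1" "z1 \<le> z2" "z2 \<le> b" "0 \<le> remainder z1 x (u @ v)"
        "remainder z2 x u' - remainder z1 x u' \<le> 2 * \<rho>" for z1 z2
    proof (rule scale)
      show "z2 \<in> {a..b}"
        using that by auto
      note wz = window[OF wab[OF this]]
      have z1: "0 < z1"
        using that(1) window(1)[of a] ab by auto
      have "x * (z2 ^ m * z2 ^ K) * (z2 - z1) = z2 * (z2 ^ length (u @ v) * x * (z2 - z1))"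
      proof -
        have "m + K = Suc (m + K - 1)"
          using K by simp
        then have pow_eq: "z2 ^ m * z2 ^ K = z2 * z2 ^ (m + K - 1)"
          by (metis power_Suc power_add)
        show ?thesis
          unfolding len(2) pow_eq by (simp only: mult_ac)
      qed
      also have "\<dots> \<le> z2 * (2 * \<rho>)"
        using remainder_diff_lower[of z1 z2 x "u @ v" d] that x z1 wz
        by (intro mult_left_mono) (auto simp: u'_def)
      also have "\<dots> \<le> b * (2 * \<rho>)"
        using that \<rho>_pos by (intro mult_right_mono) auto
      finally show "x * (z2 ^ m * z2 ^ K) * (z2 - z1) \<le> 48 * \<rho> / 24 * b"
        by (simp add: mult.commute[of b])
    qed (use that \<rho>_pos in auto)
    consider "p \<in> {a'..b'}" | "p < a'" | "b' < p"
      by fastforce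
    then show ?thesis
    proof cases
      case 1
      then show ?thesis
        using l x \<rho>_pos by (intro bexI[of _ p]) auto
    next
      case 2
      have "a' - p \<le> 2 * (48 * \<rho>) / x * \<rho> * (b - a)"
        using 2 p ab' child w(5,6) rem' by (intro gap) (auto simp: u'_def)
      then show ?thesis
        using 2 ab' by (intro bexI[of _ a']) auto
    next
      case 3
      have "0 \<le> remainder b' x (u @ v)"
        using remainder_nonneg_prefix[of b' x "u @ v" "[d]"] rem' wb' \<rho>_le by (simp add: u'_def)
      then have "p - b' \<le> 2 * (48 * \<rho>) / x * \<rho> * (b - a)"
        using 3 p ab' child w(7) rem' by (intro gap) (auto simp: u'_def)
      then show ?thesis
        using 3 ab' by (intro bexI[of _ b']) auto
    qed
  qed
  ultimately obtain p' where "p' \<in> {a'..b'}" "\<bar>p' - p\<bar> \<le> 2 * (48 * \<rho>) / x * \<rho> * (b - a)"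
    "b' - a' \<le> 2 * 24 / x * \<rho> * (b - a)" "x / 24 * \<rho> * (b - a) \<le> b' - a'"
    by blast
  moreover have "2 * (48 * \<rho>) / x * \<rho> = 96 / x * \<rho>\<^sup>2" "2 * 24 / x = 48 / x"
    by (simp_all add: power2_eq_square)
  ultimately show ?thesis
    using child by metis
qed

lemma interval_family_nodes:
  assumes "48 / x * \<rho> \<le> 1/2"
  shows "interval_family node_intervals (x / 24 * \<rho>) (48 / x * \<rho>) (96 / x * \<rho>\<^sup>2)"
proof
  show "a < b" if "(a, b) \<in> node_intervals" for a b
    using that by (auto simp: node_intervals_def node_def)
  show "\<exists>a' b' p'. (a', b') \<in> node_intervals \<and> a \<le> a' \<and> b' \<le> b \<and> x / 24 * \<rho> * (b - a) \<le> b' - a'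
      \<and> b' - a' \<le> 48 / x * \<rho> * (b - a) \<and> p' \<in> {a'..b'} \<and> \<bar>p' - p\<bar> \<le> 96 / x * \<rho>\<^sup>2 * (b - a)"
    if "(a, b) \<in> node_intervals" "p \<in> {a..b}" for a b p
    using that node_refine unfolding node_intervals_def by blast
qed (use x \<rho>_pos assms in auto)

text \<open>A short interval belongs to a long word, so arbitrarily long initial words of the expansion are
  forced.\<close>

lemma fine_points_univoque:
  assumes "p \<in> fine_points node_intervals"
  shows "p \<in> univoque_bases M x"
proof -
  have p: "\<exists>u. n < length u \<and> set u \<subseteq> {..M} \<and> forced M p x u \<and> 3/2 \<le> p \<and> p < real M + 1" for n
  proof -
    define Q where "Q = real M + 1"
    have Q: "1 < Q"
      using M by (simp add: Q_def)
    obtain a b where ab: "(a, b) \<in> node_intervals" "p \<in> {a..b}" "b - a < 1 / (12 * Q ^ n)"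
      using assms Q unfolding fine_points_def by (auto dest!: spec[of _ "1 / (12 * Q ^ n)"])
    then obtain u where u: "node u a b"
      by (auto simp: node_intervals_def)
    then have win: "q0 \<le> a" "a < b" "b < Q" "set u \<subseteq> {..M}" "\<forall>p\<in>{a..b}. forced M p x u"
      by (auto simp: node_def Q_def)
    have b: "1 < b"
      using window(1)[of b] win by (simp add: Q_def)
    have "n < length u"
    proof (rule ccontr)
      assume "\<not> n < length u"
      have "b ^ length u \<le> Q ^ length u"
        using win b by (intro power_mono) auto
      also have "\<dots> \<le> Q ^ n"
        using \<open>\<not> n < length u\<close> Q by (intro power_increasing) auto
      finally have "12 * (b ^ length u * (b - a)) \<le> 12 * (Q ^ n * (b - a))"
        using win by (intro mult_left_mono mult_right_mono) auto
      also have "\<dots> < 1"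
        using ab(3) Q by (simp add: field_simps)
      finally show False
        using node_size(2)[OF u] b by simp
    qed
    then show ?thesis
      using ab win window(1)[of p] by (auto simp: Q_def intro!: exI[of _ u])
  qed
  have p1: "1 < p" "p \<le> real M + 1"
    using p[of 0] by auto
  have "d = e" if "is_expansion M p x d" "is_expansion M p x e" for d e
  proof
    fix i
    obtain u where "i < length u" "set u \<subseteq> {..M}" "forced M p x u"
      using p by blast
    then show "d i = e i"
      using forced_expansion[of M p x u _ i] that p1 by metis
  qed
  then show ?thesis
    using expansion_exists[OF p1 x] p1 by (auto simp: univoque_bases_def)
qed

end

section \<open>A first interval close to the largest base\<close>

context base_window
begin

text \<open>Let \<open>D\<close> be the quasi-greedy word of length \<open>N\<close> in base \<open>Q = M + 1\<close>, with remainder \<open>y \<ge> 1 / Q\<close>. Over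
  the window the remainder behind \<open>D\<close> drops from \<open>y\<close> by at least \<open>\<sigma> = x / (8 * Q)\<close>. Aim at bases where
  it is about \<open>y - \<sigma> / 2\<close>, and append the quasi-greedy block \<open>w\<close> for this value. Shifting the remainder
  behind \<open>D\<close> by \<open>\<sigma> / 4\<close> up or down shifts the one behind \<open>D @ w\<close> by at least \<open>1\<close>, unless it becomes
  negative, so the interval of \<open>D @ w\<close> lies between the bases \<open>p1\<close> and \<open>p3\<close> that belong to these shifts.

  The digits of \<open>D\<close> are forced there: their remainders are smaller than in base \<open>Q\<close>, where they are at
  most \<open>1\<close>, and going back from a remainder of at least \<open>1 / (2 * Q)\<close> behind \<open>D\<close> they are at least
  \<open>1 / (2 * Q ^ N)\<close>, whereas \<open>M / (p - 1) - 1\<close> is at most \<open>1 / (4 * Q ^ N)\<close> by the choice of the window.\<close>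

lemma node_exists:
  assumes N: "1 \<le> N" "m0 \<le> N" and tail: "1 / (real M + 1) \<le> quasi_greedy_tail (real M + 1) x N"
    and q0_eq: "q0 = real M + 1 - 1 / (8 * (real M + 1) ^ N)"
    and \<rho>_small: "\<rho> \<le> x / (64 * (real M + 1))"
  shows "\<exists>u a b. node u a b"
proof -
  define Q where "Q = real M + 1"
  have Q: "2 \<le> Q" "0 < Q"
    using M by (auto simp: Q_def)
  define D where "D = quasi_greedy_word Q x N"
  define y where "y = quasi_greedy_tail Q x N"
  define \<sigma> where "\<sigma> = x / (8 * Q)"
  define F where "F q = remainder q x D" for q
  have D: "length D = N" "set D \<subseteq> {..M}"
    using set_quasi_greedy_word[of Q M x N] Q x by (auto simp: D_def Q_def)
  have y: "1 / Q \<le> y" "y \<le> 1"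
    using tail quasi_greedy_tail[of Q M x N] Q x by (auto simp: y_def Q_def)
  have \<sigma>: "0 < \<sigma>" "\<sigma> \<le> 1 / Q / 8"
    using x Q by (auto simp: \<sigma>_def field_simps)
  have "8 * \<rho> \<le> 8 * (x / (64 * Q))"
    using \<rho>_small by (simp only: Q_def)
  then have \<sigma>\<rho>: "8 * \<rho> \<le> \<sigma>"
    by (simp add: \<sigma>_def)
  have FQ: "F Q = y"
    by (simp add: F_def D_def y_def remainder_quasi_greedy_word)
  have q0Q: "q0 < Q"
    using Q by (simp add: q0_eq Q_def)
  note win = window[folded Q_def]
  have pos: "0 < p" if "q0 \<le> p" for p
    using q0 M that by simp
  have Fq0: "F q0 \<le> y - \<sigma>"
  proof (cases "0 \<le> F q0")
    case True
    obtain v d where v: "D = v @ [d]"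
      using D(1) N(1) by (cases D rule: rev_cases) auto
    have "0 \<le> remainder q0 x v"
      using remainder_nonneg_prefix[of q0 x v "[d]"] True pos v by (simp add: F_def)
    then have "Q ^ length v * x * (Q - q0) \<le> F Q - F q0"
      unfolding F_def v using remainder_diff_lower[of q0 Q x v d] q0Q x pos by simp
    moreover have "Q ^ length v * x * (Q - q0) = \<sigma>"
    proof -
      have "N = Suc (length v)"
        using v D(1) by simp
      then show ?thesis
        using Q by (simp add: q0_eq Q_def[symmetric] \<sigma>_def)
    qed
    ultimately show ?thesis
      using FQ by simp
  next
    case False
    then show ?thesis
      using y \<sigma> Q by simp
  qed
  have contF: "continuous_on A F" for A
    unfolding F_def by (intro continuous_on_remainder continuous_intros)
  obtain p3 where p3: "q0 \<le> p3" "p3 \<le> Q" "F p3 = y - \<sigma> / 4"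
    using IVT'[of F q0 "y - \<sigma> / 4" Q] Fq0 FQ \<sigma> q0Q contF by auto
  obtain p2 where p2: "q0 \<le> p2" "p2 \<le> p3" "F p2 = y - \<sigma> / 2"
    using IVT'[of F q0 "y - \<sigma> / 2" p3] Fq0 \<sigma> p3 contF by auto
  obtain p1 where p1: "q0 \<le> p1" "p1 \<le> p2" "F p1 = y - 3 / 4 * \<sigma>"
    using IVT'[of F q0 "y - 3 / 4 * \<sigma>" p2] Fq0 \<sigma> p2 contF by auto
  have "p3 \<noteq> Q"
    using p3 FQ \<sigma> by auto
  then have p3Q: "p3 < Q"
    using p3 by simp
  define t where "t = y - \<sigma> / 2"
  have t: "0 < t" "t \<le> 1"
    using y \<sigma> Q by (auto simp: t_def)
  define w where "w = quasi_greedy_word p2 t K"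
  have p2Q: "0 < p2" "p2 \<le> real M + 1"
    using pos p2 p3Q by (auto simp: Q_def)
  have w: "length w = K" "set w \<subseteq> {..M}" "0 < remainder p2 t w" "remainder p2 t w \<le> 1"
    using set_quasi_greedy_word[OF p2Q t] quasi_greedy_tail[OF p2Q t, of K]
    by (auto simp: w_def remainder_quasi_greedy_word)
  define G where "G q = remainder q x (D @ w)" for q
  have contG: "continuous_on A G" for A
    unfolding G_def by (intro continuous_on_remainder continuous_intros)
  have G2: "0 < G p2" "G p2 \<le> 1"
    using w p2(3) by (auto simp: G_def F_def remainder_append t_def)
  have stretch: "G p + 1 \<le> G q" if "q0 \<le> p" "p \<le> q" "q < Q" "0 \<le> G p" "F q - F p = \<sigma> / 4" for p q
  proof -
    have "1 \<le> \<sigma> / 4 * (1 / (2 * \<rho>))"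
      using \<sigma>\<rho> \<rho>_pos by (simp add: field_simps)
    also have "\<dots> \<le> \<sigma> / 4 * q ^ K"
      using win(4)[of q] that \<sigma> by (intro mult_left_mono) auto
    also have "\<dots> = q ^ length w * (F q - F p)"
      by (simp add: that w)
    also have "\<dots> \<le> G q - G p"
      unfolding F_def G_def using that pos by (intro remainder_diff_extend) (auto simp: G_def)
    finally show ?thesis
      by simp
  qed
  have G1: "G p1 \<le> \<rho>"
  proof (rule ccontr)
    assume "\<not> G p1 \<le> \<rho>"
    then have "G p1 + 1 \<le> G p2"
      using p1 p2 p3Q \<rho>_pos by (intro stretch) auto
    then show False
      using G2 \<open>\<not> G p1 \<le> \<rho>\<close> \<rho>_pos by simp
  qed
  have "G p2 + 1 \<le> G p3"
    using p2 p3 p3Q G2 by (intro stretch) auto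
  then have G3: "1 - \<rho> \<le> G p3"
    using G2 \<rho>_pos by simp
  obtain a where a: "p1 \<le> a" "a \<le> p3" "G a = \<rho>"
    using IVT'[of G p1 \<rho> p3] G1 G3 p1 p2 \<rho>_le contG by auto
  obtain b where b: "a \<le> b" "b \<le> p3" "G b = 1 - \<rho>"
    using IVT'[of G a "1 - \<rho>" p3] a G3 \<rho>_le contG by auto
  have "a \<noteq> b"
    using a b \<rho>_le by auto
  have "forced M p x (D @ w)" if p: "p \<in> {a..b}" for p
  proof -
    have win_p: "q0 \<le> p" "p < real M + 1" "p < Q"
      using p a b p1 p3Q by (auto simp: Q_def)
    note wp = win[OF win_p(1,3)]
    have Gp: "\<rho> \<le> G p"
      using remainder_mono[of a p x "D @ w"] a p pos p1 x \<rho>_pos by (simp add: G_def)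
    have Gp': "G p \<le> 1 - \<rho>"
      using remainder_mono[of p b x "D @ w"] b p pos win_p x \<rho>_pos Gp by (simp add: G_def)
    have "0 \<le> F p1"
      using y \<sigma> p1 by simp
    then have "F p1 \<le> F p"
      using remainder_mono[of p1 p x D] a p pos p1 x by (simp add: F_def)
    then have Fp: "1 / (2 * Q) \<le> F p"
    proof -
      obtain i where i: "i = 1 / Q"
        by simp
      have "1 / (2 * Q) = i / 2" "0 < i"
        using Q by (simp_all add: i)
      then show ?thesis
        using p1(3) y(1)[folded i] \<sigma>(2)[folded i] \<open>F p1 \<le> F p\<close> by linarith
    qed
    have "0 < 1 / (2 * Q)"
      using Q by simp
    then have Fp0: "0 \<le> F p"
      using Fp by linarith
    have "forced M p x D"
    proof (rule forcedI)
      fix v d w' assume split: "D = v @ d # w'"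
      define s where "s = remainder p x (v @ [d])"
      have len: "N = Suc (length v + length w')"
        using split D(1) by simp
      have Fs: "F p = remainder p s w'"
        by (simp add: F_def s_def split remainder_append)
      have "max_value M p - 1 < s"
      proof -
        have "max_value M p - 1 = (Q - p) / (p - 1)"
          using wp by (simp add: max_value_def Q_def field_simps)
        also have "\<dots> \<le> (Q - q0) / (1 / 2)"
          using wp win_p by (intro frac_le) auto
        also have "\<dots> = 1 / (4 * Q ^ N)"
          by (simp add: q0_eq Q_def[symmetric])
        finally have 1: "Q ^ N * (max_value M p - 1) \<le> 1 / 4"
          using Q by (simp add: field_simps)
        have s: "0 \<le> s"
          using remainder_nonneg_prefix[of p s "[]" w'] pos win_p Fs Fp0 by simp
        have "1 / (2 * Q) \<le> p ^ length w' * s"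
          using Fp Fs remainder_le[of p s w'] pos win_p by simp
        also have "\<dots> \<le> Q ^ length w' * s"
          using s pos[OF win_p(1)] win_p by (intro mult_right_mono power_mono) auto
        also have "\<dots> \<le> Q ^ (N - 1) * s"
          using s Q len by (intro mult_right_mono power_increasing) auto
        finally have "Q * (1 / (2 * Q)) \<le> Q * (Q ^ (N - 1) * s)"
          using Q by (intro mult_left_mono) auto
        also have "\<dots> = Q ^ N * s"
          using len by simp
        finally have "1 / 2 \<le> Q ^ N * s"
          using Q by simp
        then have "Q ^ N * (max_value M p - 1) < Q ^ N * s"
          using 1 by linarith
        then show ?thesis
          by (rule mult_left_less_imp_less) (use Q in simp)
      qed
      moreover have "s < 1"
      proof -
        have "0 \<le> remainder p x (v @ d # w')"
          using Fp0 by (simp add: F_def split)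
        then have "0 \<le> remainder p x v"
          using remainder_nonneg_prefix pos[OF win_p(1)] by blast
        then have "Q ^ length v * x * (Q - p) \<le> remainder Q x (v @ [d]) - s"
          unfolding s_def using pos[OF win_p(1)] win_p x by (intro remainder_diff_lower) auto
        moreover have "0 < Q ^ length v * x * (Q - p)"
          using Q x win_p by simp
        moreover have "remainder Q x (v @ [d]) \<le> 1"
        proof -
          have "v @ [d] = quasi_greedy_word Q x (length (v @ [d]))"
            using quasi_greedy_prefix[of Q x N "v @ [d]" w'] split by (simp add: D_def)
          then have "remainder Q x (v @ [d]) = quasi_greedy_tail Q x (length (v @ [d]))"
            using remainder_quasi_greedy_word by metis
          moreover have "quasi_greedy_tail Q x (length (v @ [d])) \<le> 1"
            using quasi_greedy_tail[of Q M x "length (v @ [d])"] Q x by (simp only: Q_def)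
          ultimately show ?thesis
            by (simp only:)
        qed
        ultimately show ?thesis
          by simp
      qed
      ultimately show "max_value M p - 1 < remainder p x (v @ [d]) \<and> (d < M \<longrightarrow> remainder p x (v @ [d]) < 1)"
        by (simp add: s_def)
    qed
    moreover have "forced M p (remainder p x D) w"
      using forced_word[OF win_p(1,2) w(1,2)] Gp Gp' by (simp add: G_def remainder_append)
    ultimately show ?thesis
      by (simp add: forced_append)
  qed
  then have "node (D @ w) a b"
    using N D w(1,2) K a b p1 p3Q \<open>a \<noteq> b\<close> by (auto simp: node_def G_def Q_def)
  then show ?thesis
    by blast
qed

end

section \<open>The image of the univoque bases\<close>

lemma linear_le_exponential:
  assumes "0 < x"
  shows "\<exists>m0. \<forall>m\<ge>m0. \<forall>q\<ge>3/2. 2 * real m \<le> x * q ^ m"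
proof -
  have "(\<lambda>n. of_nat n * (2 / 3) ^ n) \<longlonglongrightarrow> (0 :: real)"
    by (rule powser_times_n_limit_0) simp
  then have "\<forall>\<^sub>F n in sequentially. real n * (2 / 3) ^ n < x / 2"
    using assms by (intro order_tendstoD) auto
  then obtain m0 where m0: "\<And>m. m0 \<le> m \<Longrightarrow> real m * (2 / 3) ^ m < x / 2"
    by (auto simp: eventually_sequentially)
  have "2 * real m \<le> x * q ^ m" if "m0 \<le> m" "3/2 \<le> q" for m and q :: real
  proof -
    have "2 * real m \<le> x * (3 / 2) ^ m"
      using m0[OF that(1)] by (simp add: power_divide field_simps)
    also have "\<dots> \<le> x * q ^ m"
      using that assms by (intro mult_left_mono power_mono) auto
    finally show ?thesis .
  qed
  then show ?thesis
    by blast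
qed

theorem theorem4p1:
  fixes M :: nat and f :: "real \<times> real \<Rightarrow> real" and \<delta> x :: real
  assumes "M \<ge> 1"
    and "C1 f"
    and "\<delta> > 0"
    and "\<And>z. z \<in> {real M + 1 - \<delta><..real M + 1} \<times> {real M + 1 - \<delta><..real M + 1} \<Longrightarrow>
           partial_fst f z \<noteq> 0 \<and> partial_snd f z \<noteq> 0"
    and "x \<in> {0<..1}"
  shows "\<exists>a b. a < b \<and> {a..b} \<subseteq> univoque_image M f x"
proof -
  define Q where "Q = real M + 1"
  have Q: "2 \<le> Q" "1 < Q"
    using assms(1) by (auto simp: Q_def)
  have x_range: "0 < x" "x \<le> 1"
    using assms(5) by auto
  define S where "S = {Q - \<delta> / 2..Q}"
  obtain m L where m: "0 < m" and L: "1 \<le> L"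
    and bilip: "\<And>p p' q. p \<in> S \<Longrightarrow> p' \<in> S \<Longrightarrow> q \<in> S \<Longrightarrow>
       m * \<bar>p - p'\<bar> \<le> \<bar>f (p, q) - f (p', q)\<bar> \<and> \<bar>f (p, q) - f (p', q)\<bar> \<le> m * L * \<bar>p - p'\<bar>"
    "\<And>p q q'. p \<in> S \<Longrightarrow> q \<in> S \<Longrightarrow> q' \<in> S \<Longrightarrow>
       m * \<bar>q - q'\<bar> \<le> \<bar>f (p, q) - f (p, q')\<bar> \<and> \<bar>f (p, q) - f (p, q')\<bar> \<le> m * L * \<bar>q - q'\<bar>"
    unfolding S_def
    by (rule C1_bilipschitz[OF assms(2), of "Q - \<delta> / 2" Q]) (use assms(3,4) in \<open>auto simp: Q_def\<close>)
  \<comment> \<open>The block length comes first: it makes \<open>\<rho>\<close> small in terms of \<open>x\<close> and the Lipschitz constants.\<close>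
  define c where "c = min (1/4) (min (x / (64 * Q)) (x ^ 4 / (3 * 10 ^ 8 * L\<^sup>2)))"
  have "0 < c"
    using x_range L Q by (auto simp: c_def)
  then obtain k where k: "(1 / Q) ^ k < c"
    using real_arch_pow_inv[of c "1 / Q"] Q by auto
  define K where "K = max 2 k"
  define \<rho> where "\<rho> = 1 / Q ^ K"
  have "\<rho> \<le> (1 / Q) ^ k"
    using power_decreasing[of k K "1 / Q"] Q by (simp add: \<rho>_def K_def power_one_over)
  then have "\<rho> \<le> c"
    using k by simp
  then have \<rho>_bounds: "0 < \<rho>" "\<rho> \<le> 1/4" "\<rho> \<le> x / (64 * Q)" "\<rho> \<le> x ^ 4 / (3 * 10 ^ 8 * L\<^sup>2)"
    using Q unfolding c_def by (auto simp: \<rho>_def[symmetric]) (simp add: \<rho>_def)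
  obtain m0 where m0: "\<And>m q. m0 \<le> m \<Longrightarrow> 3/2 \<le> q \<Longrightarrow> 2 * real m \<le> x * q ^ m"
    using linear_le_exponential[OF x_range(1)] by blast
  \<comment> \<open>The window is chosen afterwards, in terms of \<open>\<rho>\<close>: it has to satisfy the assumptions of the locale and to lie in the region where the partial derivatives do not vanish.\<close>
  define \<epsilon> where "\<epsilon> = min (\<rho>\<^sup>2 / 4) (min (\<rho> / K) (\<delta> / 2))"
  have "0 < \<epsilon>"
    using \<rho>_bounds assms(3) by (auto simp: \<epsilon>_def K_def)
  then obtain n where n: "(1 / Q) ^ n < \<epsilon>"
    using real_arch_pow_inv[of \<epsilon> "1 / Q"] Q by auto
  obtain N where N: "max (max 1 m0) n \<le> N" and tail: "1 / Q \<le> quasi_greedy_tail Q x N"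
    using quasi_greedy_tail_large[of Q M x "max (max 1 m0) n"] Q x_range by (auto simp: Q_def)
  define q0 where "q0 = Q - 1 / (8 * Q ^ N)"
  have "1 / (8 * Q ^ N) \<le> 1 / Q ^ N"
    using Q by (simp add: field_simps)
  also have "\<dots> \<le> (1 / Q) ^ n"
    using power_decreasing[of n N "1 / Q"] N Q by (simp add: power_one_over)
  finally have eta: "Q - q0 < \<rho>\<^sup>2 / 4" "Q - q0 < \<rho> / K" "Q - q0 < \<delta> / 2"
    using n by (auto simp: q0_def \<epsilon>_def)
  have "\<rho>\<^sup>2 \<le> 1"
    using \<rho>_bounds by (simp add: power_le_one)
  have q0_ge: "Q - 1/2 \<le> q0"
    using eta(1) \<open>\<rho>\<^sup>2 \<le> 1\<close> by simp
  interpret base_window M K m0 x \<rho> q0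
  proof
    show "max_value M q - 1 < \<rho>\<^sup>2" if "q0 \<le> q" "q < real M + 1" for q
    proof -
      have "3/2 \<le> q"
        using that q0_ge Q by simp
      then have "max_value M q - 1 = (Q - q) / (q - 1)"
        by (simp add: max_value_def Q_def field_simps)
      also have "\<dots> \<le> (Q - q0) / (1 / 2)"
        using that \<open>3/2 \<le> q\<close> by (intro frac_le) (auto simp: Q_def)
      also have "\<dots> < \<rho>\<^sup>2 / 4 / (1 / 2)"
        by (intro divide_strict_right_mono eta) simp
      also have "\<dots> \<le> \<rho>\<^sup>2"
        by simp
      finally show ?thesis .
    qed
    show "1 - \<rho> \<le> q ^ K * \<rho>" if "q0 \<le> q" "q < real M + 1" for q
    proof -
      have q: "0 \<le> q"
        using that q0_ge Q by simp
      have "(Q - q) / Q \<le> (Q - q) / 1"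
        using that Q by (intro divide_left_mono) (auto simp: Q_def)
      then have "1 - q / Q \<le> Q - q"
        using Q by (simp add: diff_divide_distrib)
      then have "real K * (1 - q / Q) \<le> real K * (Q - q)"
        by (intro mult_left_mono) auto
      also have "\<dots> \<le> real K * (\<rho> / K)"
        using that eta(2) by (intro mult_left_mono) auto
      also have "\<dots> = \<rho>"
        by (simp add: K_def)
      finally have "1 - \<rho> \<le> 1 + real K * (q / Q - 1)"
        by (simp add: algebra_simps)
      also have "\<dots> \<le> (1 + (q / Q - 1)) ^ K"
        using q Q by (intro Bernoulli_inequality) simp
      also have "\<dots> = q ^ K * \<rho>"
        by (simp add: \<rho>_def power_divide)
      finally show ?thesis .
    qed
  qed (use assms(1) x_range \<rho>_bounds q0_ge m0 in \<open>auto simp: K_def \<rho>_def Q_def\<close>)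
  define \<alpha> \<beta> h r where "\<alpha> = x / 24 * \<rho>" and "\<beta> = 48 / x * \<rho>" and "h = 96 / x * \<rho>\<^sup>2"
    and "r = x ^ 3 / (442368 * L)"
  have "\<rho> \<le> 1"
    using \<rho>_bounds by simp
  note scale = scale_inequalities[OF x_range L \<rho>_bounds(1) this \<rho>_bounds(4), folded \<alpha>_def \<beta>_def h_def r_def]
  interpret family: interval_family node_intervals \<alpha> \<beta> h
    using interval_family_nodes scale(1) unfolding \<alpha>_def \<beta>_def h_def by simp
  interpret level_sets node_intervals \<alpha> \<beta> h f S m L r
  proof
    show "{a..b} \<subseteq> S" if "(a, b) \<in> node_intervals" for a b
      using that eta(3) by (auto simp: node_intervals_def node_def S_def Q_def)
  qed (use m L bilip C1_partials(1)[OF assms(2)] scale in auto)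
  obtain u a b where "node u a b"
    using node_exists[of N] N tail \<rho>_bounds(3) by (auto simp: q0_def Q_def)
  then have "(a, b) \<in> node_intervals"
    by (auto simp: node_intervals_def)
  then obtain t0 t1 where "t0 < t1"
    "{t0..t1} \<subseteq> {f (p, q) |p q. p \<in> fine_points node_intervals \<and> q \<in> fine_points node_intervals}"
    using image_contains_interval scale(5,6) by blast
  moreover have "{f (p, q) |p q. p \<in> fine_points node_intervals \<and> q \<in> fine_points node_intervals}
      \<subseteq> univoque_image M f x"
    unfolding univoque_image_def using fine_points_univoque by blast
  ultimately show ?thesis
    by blast
qed

end
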